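(* Let $A\in\mathbb{R}^{d\times d}$ be symmetric, $b\in\mathbb{R}^d$, $\rho\ge0$, and $f(x)=\frac12x^TAx+b^Tx+\frac{\rho}{3}\|x\|^3$. Let $x_\star$ be a global minimizer of $f$ over $\mathbb{R}^d$, and write $f^\star=f(x_\star)$. For each integer $t\ge1$ let $x_t\in\operatorname*{argmin}_{x\in\mathcal{K}_t(A,b)}f(x)$. Then for every $t\ge1$, $$f(x_t)-f^\star\le36\,[f(0)-f^\star]\exp\left\{-4t\sqrt{\frac{\lambda_{\min}+\rho\|x_\star\|}{\lambda_{\max}+\rho\|x_\star\|}}\right\},$$ and $$f(x_t)-f^\star\le\frac{(\lambda_{\max}-\lambda_{\min})\|x_\star\|^2}{(t-\frac12)^2}\left[4+\frac{\mathbb{I}_{\{\lambda_{\min}<0\}}}{8}\log^2\left(\frac{4\|b\|^2}{(b^{(1)})^2}\right)\right].$$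
   Context: $\|\cdot\|$ is the Euclidean norm. $\lambda_{\min},\lambda_{\max}$ are the smallest and largest eigenvalues of $A$, and $b^{(1)}=v_{\min}^Tb$, where $v_{\min}$ is a unit eigenvector of $A$ for $\lambda_{\min}$. The Krylov subspace is $\mathcal{K}_t(A,b)=\mathrm{span}\{b,Ab,\dots,A^{t-1}b\}$. A global minimizer $x_\star$ is assumed to exist (automatic if $\rho>0$). $\mathbb{I}$ denotes an indicator ($0/1$ valued). Degenerate conventions: a ratio $0/0$ in the first bound is read as $0$; when $\lambda_{\min}<0$ and $b^{(1)}=0$ the second bound is vacuous (right-hand side $+\infty$), and when $\lambda_{\min}\ge0$ the logarithmic term is absent. *)

theory Defs
  imports "HOL-Analysis.Analysis"
begin

definition eigenvalues :: "real ^ 'n ^ 'n \<Rightarrow> real set" where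
  "eigenvalues A = {l. \<exists>v. v \<noteq> 0 \<and> A *v v = l *\<^sub>R v}"

text \<open>For a symmetric matrix the set of eigenvalues is finite and nonempty, so these are
  its least and greatest elements.\<close>

definition lambda_min :: "real ^ 'n ^ 'n \<Rightarrow> real" where
  "lambda_min A = Min (eigenvalues A)"

definition lambda_max :: "real ^ 'n ^ 'n \<Rightarrow> real" where
  "lambda_max A = Max (eigenvalues A)"

definition krylov :: "real ^ 'n ^ 'n \<Rightarrow> real ^ 'n \<Rightarrow> nat \<Rightarrow> (real ^ 'n) set" where
  "krylov A b t = span ((\<lambda>i. ((\<lambda>v. A *v v) ^^ i) b) ` {..<t})"

definition cubic_objective :: "real ^ 'n ^ 'n \<Rightarrow> real ^ 'n \<Rightarrow> real \<Rightarrow> real ^ 'n \<Rightarrow> real" where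
  "cubic_objective A b \<rho> x = (1/2) * (x \<bullet> (A *v x)) + b \<bullet> x + (\<rho> / 3) * norm x ^ 3"

end

theory Submission
  imports Defs
begin

text \<open>
  Put $\lambda = \rho\|x_\star\|$. Global minimality gives $(A + \lambda I)x_\star = -b$,
  $A + \lambda I \succeq 0$, and
  $f(x) - f^\star = \frac12 \|x - x_\star\|_{A + \lambda I}^2
    + \frac\rho6 (\|x_\star\| - \|x\|)^2 (\|x_\star\| + 2\|x\|)$,
  so it suffices to find good points of the Krylov subspace on the sphere through $x_\star$.
  The subspace contains $y = (I - r(A + \lambda I))x_\star$ for every polynomial $r$ of degree at
  most $t$ with $r(0) = 1$.

  For the linear rate, $r$ is the Chebyshev polynomial. If $|r| \le \epsilon \le 1/3$ on the
  spectrum, then rescaling $y$ to norm $\|x_\star\|$ changes the relative error in each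
  eigendirection from $\epsilon$ to at most $3\epsilon$, and if $\epsilon > 1/3$ the bound
  follows from $f(x_t) \le f(0)$.

  For the sublinear rate, $r$ takes values in $[0,1]$, so that $y$ stays in the ball, and $z\,r(z)$
  is small; this bounds the convex quadratic with matrix $A - \lambda_{\min} I$ at $y$. If
  $\lambda_{\min} < 0$, the sphere is then reached from $y$ along a Lanczos vector, an approximate
  eigenvector for $\lambda_{\min}$ in the Krylov subspace.
\<close>

section \<open>Eigenbases and Krylov subspaces\<close>

text \<open>Divide by \<open>t\<close> and let \<open>t\<close> tend to 0. This replaces
  differentiation in three variational arguments: the maximizer of a quadratic form on the sphere,
  stationarity of the cubic minimizer, and its second-order condition.\<close>

lemma linear_coeff_nonpos_if_quadratic_bound:
  fixes a c :: real
  assumes "\<And>t. 0 < t \<Longrightarrow> t < 1 \<Longrightarrow> t * a \<le> t\<^sup>2 * c"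
  shows "a \<le> 0"
proof (rule field_le_epsilon)
  fix e :: real assume e: "e > 0"
  define t where "t = min (1/2) (e / (1 + \<bar>c\<bar>))"
  have t: "0 < t" "t < 1" "t \<le> e / (1 + \<bar>c\<bar>)" using e by (auto simp: t_def)
  have "t * a \<le> t * (t * c)" using assms[OF t(1,2)] by (simp add: power2_eq_square mult.assoc)
  then have "a \<le> t * c" using t(1) by simp
  also have "\<dots> \<le> t * (1 + \<bar>c\<bar>)" using t by (intro mult_left_mono) auto
  also have "\<dots> \<le> e" using t(3) by (simp add: field_simps)
  finally show "a \<le> 0 + e" by simp
qed

text \<open>Spectral theorem on an invariant subspace, by induction on dimension: a maximizer of the
  quadratic form on the unit sphere of \<open>S\<close> is an eigenvector, and its orthogonal
  complement within \<open>S\<close> is again invariant.\<close>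

lemma selfadjoint_eigenbasis:
  fixes f :: "'a::euclidean_space \<Rightarrow> 'a"
  assumes "linear f" and self: "\<And>x y. x \<bullet> f y = f x \<bullet> y"
    and "subspace S" and "\<And>x. x \<in> S \<Longrightarrow> f x \<in> S"
  shows "\<exists>B. finite B \<and> B \<subseteq> S \<and> pairwise orthogonal B \<and> (\<forall>v\<in>B. norm v = 1) \<and> span B = S
           \<and> (\<forall>v\<in>B. \<exists>l. f v = l *\<^sub>R v)"
  using assms(3,4)
proof (induction "dim S" arbitrary: S rule: less_induct)
  case less
  interpret f: linear f by fact
  note S = less.prems
  show ?case
  proof (cases "S = {0}")
    case True
    then show ?thesis by (intro exI[of _ "{}"]) (auto simp: pairwise_empty)
  next
    case False
    then obtain x0 where x0: "x0 \<in> S" "x0 \<noteq> 0" using S(1) subspace_0 by blast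
    let ?U = "sphere 0 1 \<inter> S"
    have "compact ?U" using closed_subspace[OF S(1)] by (simp add: compact_Int_closed)
    moreover have "x0 /\<^sub>R norm x0 \<in> ?U" using x0 S(1) by (auto simp: subspace_scale)
    then have "?U \<noteq> {}" by blast
    moreover have "continuous_on ?U (\<lambda>x. x \<bullet> f x)"
      using linear_continuous_on[of f ?U] assms(1)
      by (intro continuous_intros) (auto simp: linear_conv_bounded_linear)
    ultimately obtain v where v: "v \<in> ?U" and vmax: "\<And>x. x \<in> ?U \<Longrightarrow> x \<bullet> f x \<le> v \<bullet> f v"
      by (meson continuous_attains_sup)
    define l where "l = v \<bullet> f v"
    have nv: "norm v = 1" "v \<in> S" "v \<bullet> v = 1" using v by (auto simp: dot_square_norm)
    have ray: "x \<bullet> f x \<le> l * (x \<bullet> x)" if "x \<in> S" for x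
    proof (cases "x = 0")
      case False
      have "x /\<^sub>R norm x \<in> ?U" using that S(1) False by (auto simp: subspace_scale)
      from vmax[OF this] have "(x \<bullet> f x) / (norm x)\<^sup>2 \<le> l"
        by (simp add: f.scale l_def power2_eq_square field_simps)
      then show ?thesis using False by (simp add: dot_square_norm pos_divide_le_eq)
    qed (simp add: f.zero)
    \<comment> \<open>\<open>w\<close> is the component of \<open>f v\<close> orthogonal to
      \<open>v\<close>. Moving from \<open>v\<close> in the direction \<open>w\<close> changes the
      form to first order by \<open>2 * (w \<bullet> w)\<close>, so maximality forces
      \<open>w = 0\<close>.\<close>
    define w where "w = f v - l *\<^sub>R v"
    have wS: "w \<in> S" unfolding w_def using S nv by (intro subspace_diff subspace_scale) auto
    have wv: "w \<bullet> v = 0" "v \<bullet> w = 0" using nv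
      by (auto simp: w_def l_def inner_diff_left inner_diff_right inner_commute)
    have wf: "w \<bullet> f v = w \<bullet> w" using wv by (simp add: w_def inner_diff_right inner_diff_left)
    have "2 * (w \<bullet> w) \<le> 0"
    proof (rule linear_coeff_nonpos_if_quadratic_bound)
      fix t :: real
      have "v + t *\<^sub>R w \<in> S" using S(1) nv wS by (intro subspace_add subspace_scale)
      from ray[OF this] have "l + 2 * t * (w \<bullet> f v) + t\<^sup>2 * (w \<bullet> f w) \<le> l * (1 + t\<^sup>2 * (w \<bullet> w))"
        using wv nv self[of v w]
        by (simp add: f.add f.scale inner_add_left inner_add_right l_def power2_eq_square
              algebra_simps inner_commute)
      then show "t * (2 * (w \<bullet> w)) \<le> t\<^sup>2 * (l * (w \<bullet> w) - w \<bullet> f w)"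
        unfolding wf by (simp add: algebra_simps)
    qed
    then have "w = 0" using inner_gt_zero_iff[of w] by fastforce
    then have fv: "f v = l *\<^sub>R v" by (simp add: w_def)
    define S' where "S' = {x \<in> S. v \<bullet> x = 0}"
    have sub: "subspace S'" using S(1)
      by (auto simp: S'_def subspace_def inner_add_right)
    have "f x \<in> S'" if "x \<in> S'" for x
      using that S(2) self[of v x] fv by (auto simp: S'_def)
    moreover have "dim S' < dim S"
    proof (rule dim_psubset)
      have "v \<notin> S'" using nv by (simp add: S'_def)
      moreover have "S' \<subseteq> S" by (auto simp: S'_def)
      ultimately show "span S' \<subset> span S"
        using nv(2) S(1) sub by (metis psubsetI span_eq_iff)
    qed
    ultimately obtain B where B: "finite B" "B \<subseteq> S'" "pairwise orthogonal B" "\<forall>v\<in>B. norm v = 1"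
      "span B = S'" "\<forall>v\<in>B. \<exists>l. f v = l *\<^sub>R v"
      using less.hyps[OF _ sub] by blast
    have "pairwise orthogonal (insert v B)"
      using B(2,3) by (auto simp: pairwise_insert S'_def orthogonal_def inner_commute)
    moreover have "span (insert v B) = S"
    proof
      show "span (insert v B) \<subseteq> S" using B(2) nv S(1)
        by (intro span_minimal) (auto simp: S'_def)
      show "S \<subseteq> span (insert v B)"
      proof
        fix x assume "x \<in> S"
        then have "x - (v \<bullet> x) *\<^sub>R v \<in> S'" using S(1) nv
          by (auto simp: S'_def inner_diff_right intro!: subspace_diff subspace_scale)
        then show "x \<in> span (insert v B)" using B(5) by (auto simp: span_insert)
      qed
    qed
    ultimately show ?thesis using B(1,2,4,6) nv(1,2) fv
      by (intro exI[of _ "insert v B"]) (auto simp: S'_def)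
  qed
qed

lemma symmetric_inner_commute:
  fixes A :: "real ^ 'n ^ 'n"
  assumes "transpose A = A"
  shows "x \<bullet> (A *v y) = (A *v x) \<bullet> y"
  using dot_lmul_matrix[of x A y] vector_transpose_matrix[of x A] assms by simp

locale eigenbasis =
  fixes A :: "real ^ 'n ^ 'n" and B :: "(real ^ 'n) set" and ev :: "real ^ 'n \<Rightarrow> real"
  assumes finite_basis: "finite B"
    and pairwise_orthogonal: "pairwise orthogonal B"
    and norm_basis: "v \<in> B \<Longrightarrow> norm v = 1"
    and span_basis: "span B = UNIV"
    and eigenvector: "v \<in> B \<Longrightarrow> A *v v = ev v *\<^sub>R v"

text \<open>The hyperplane orthogonal to an eigenvector is invariant, so a prescribed
  \<open>u\<close> can be completed to an eigenbasis. The sublinear bound refers to one given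
  eigenvector for the least eigenvalue, which may be multiple, so that vector has to be a basis
  member.\<close>

lemma symmetric_eigenbasis_containing:
  fixes A :: "real ^ 'n ^ 'n"
  assumes sym: "transpose A = A" and u: "norm u = 1" "A *v u = l *\<^sub>R u"
  shows "\<exists>B ev. eigenbasis A B ev \<and> u \<in> B"
proof -
  let ?S = "{x. u \<bullet> x = 0}"
  have "subspace ?S" by (rule subspace_hyperplane)
  moreover have "A *v x \<in> ?S" if "x \<in> ?S" for x
    using that symmetric_inner_commute[OF sym, of u x] u by auto
  ultimately have "\<exists>B. finite B \<and> B \<subseteq> ?S \<and> pairwise orthogonal B \<and> (\<forall>v\<in>B. norm v = 1) \<and> span B = ?S
      \<and> (\<forall>v\<in>B. \<exists>l. A *v v = l *\<^sub>R v)"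
    by (intro selfadjoint_eigenbasis matrix_vector_mul_linear symmetric_inner_commute[OF sym])
  then obtain B where B: "finite B" "B \<subseteq> ?S" "pairwise orthogonal B" "\<forall>v\<in>B. norm v = 1"
    "span B = ?S" "\<forall>v\<in>B. \<exists>l. A *v v = l *\<^sub>R v"
    by blast
  have uu: "u \<bullet> u = 1" using u by (simp add: dot_square_norm)
  have "span (insert u B) = UNIV"
  proof (intro equalityI subset_UNIV subsetI)
    fix x
    have "x - (u \<bullet> x) *\<^sub>R u \<in> ?S" using uu by (auto simp: inner_diff_right)
    then show "x \<in> span (insert u B)" using B(5) by (auto simp: span_insert)
  qed
  moreover have "pairwise orthogonal (insert u B)"
    using B(2,3) by (auto simp: pairwise_insert orthogonal_def inner_commute)
  moreover have "\<forall>v\<in>insert u B. \<exists>l. A *v v = l *\<^sub>R v" using B(6) u(2) by blast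
  then obtain ev where "\<forall>v\<in>insert u B. A *v v = ev v *\<^sub>R v" by metis
  ultimately have "eigenbasis A (insert u B) ev"
    using B(1,4) u(1) by unfold_locales auto
  then show ?thesis by blast
qed

section \<open>Coordinates in an orthonormal eigenbasis\<close>

context eigenbasis
begin

text \<open>Vectors are built from their coordinates. In particular
  \<open>combo (\<lambda>v. poly p (ev v) * (v \<bullet> x))\<close> stands for the matrix
  polynomial p(A) applied to \<open>x\<close>.\<close>

definition combo :: "(real ^ 'n \<Rightarrow> real) \<Rightarrow> real ^ 'n" where
  "combo c = (\<Sum>v\<in>B. c v *\<^sub>R v)"

lemma inner_basis: "v \<in> B \<Longrightarrow> w \<in> B \<Longrightarrow> v \<bullet> w = of_bool (v = w)"
  using pairwise_orthogonal norm_basis[of w]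
  by (auto simp: pairwise_def orthogonal_def dot_square_norm)

lemma combo_coords: "combo (\<lambda>v. v \<bullet> x) = x"
  using orthonormal_basis_expand[OF pairwise_orthogonal, of x] norm_basis span_basis finite_basis
  by (simp add: combo_def inner_commute)

lemma coord_combo: "v \<in> B \<Longrightarrow> v \<bullet> combo c = c v"
  using finite_basis by (simp add: combo_def inner_sum_right inner_basis cong: sum.cong)

lemma inner_coords: "x \<bullet> y = (\<Sum>v\<in>B. (v \<bullet> x) * (v \<bullet> y))"
  by (subst combo_coords[of x, symmetric]) (simp add: combo_def inner_sum_left)

lemma norm_sq_coords: "(norm x)\<^sup>2 = (\<Sum>v\<in>B. (v \<bullet> x)\<^sup>2)"
  unfolding power2_norm_eq_inner inner_coords[of x x] by (simp add: power2_eq_square)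

lemma eq_iff_coords: "x = y \<longleftrightarrow> (\<forall>v\<in>B. v \<bullet> x = v \<bullet> y)"
proof
  assume "\<forall>v\<in>B. v \<bullet> x = v \<bullet> y"
  then have "combo (\<lambda>v. v \<bullet> x) = combo (\<lambda>v. v \<bullet> y)" by (simp add: combo_def)
  then show "x = y" by (simp only: combo_coords)
qed auto

lemma mult_combo: "A *v combo c = combo (\<lambda>v. ev v * c v)"
  by (simp add: combo_def linear_sum[OF matrix_vector_mul_linear] linear_scale[OF matrix_vector_mul_linear]
        eigenvector mult.commute cong: sum.cong)

lemma coord_mult: "v \<in> B \<Longrightarrow> v \<bullet> (A *v x) = ev v * (v \<bullet> x)"
  by (subst combo_coords[of x, symmetric]) (simp add: mult_combo coord_combo)

lemma quadratic_form_coords: "x \<bullet> (A *v x) = (\<Sum>v\<in>B. ev v * (v \<bullet> x)\<^sup>2)"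
  unfolding inner_coords[of x]
  by (intro sum.cong) (auto simp: coord_mult power2_eq_square)

text \<open>An eigenvector has a nonzero coordinate along some basis vector, and comparing that
  coordinate identifies its eigenvalue. Hence \<open>Min\<close> and \<open>Max\<close> in
  \<open>lambda_min\<close> and \<open>lambda_max\<close> range over a finite set.\<close>

lemma eigenvalues_eq: "eigenvalues A = ev ` B"
proof
  show "eigenvalues A \<subseteq> ev ` B"
  proof
    fix l assume "l \<in> eigenvalues A"
    then obtain x where x: "x \<noteq> 0" "A *v x = l *\<^sub>R x" by (auto simp: eigenvalues_def)
    then obtain v where v: "v \<in> B" "v \<bullet> x \<noteq> 0" using eq_iff_coords[of x 0] by auto
    then have "ev v = l" using coord_mult[of v x] x by simp
    then show "l \<in> ev ` B" using v by blast
  qed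
  show "ev ` B \<subseteq> eigenvalues A"
  proof
    fix l assume "l \<in> ev ` B"
    then obtain v where "v \<in> B" "l = ev v" by blast
    then show "l \<in> eigenvalues A"
      using eigenvector[of v] norm_basis[of v]
      by (auto simp: eigenvalues_def intro!: exI[of _ v])
  qed
qed

lemma ev_ge_lambda_min: "v \<in> B \<Longrightarrow> lambda_min A \<le> ev v"
  using finite_basis by (simp add: lambda_min_def eigenvalues_eq)

lemma ev_le_lambda_max: "v \<in> B \<Longrightarrow> ev v \<le> lambda_max A"
  using finite_basis by (simp add: lambda_max_def eigenvalues_eq)

lemma power_mult_coords: "v \<in> B \<Longrightarrow> v \<bullet> ((\<lambda>x. A *v x) ^^ i) b = ev v ^ i * (v \<bullet> b)"
  by (induction i) (auto simp: coord_mult)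

lemma combo_poly_in_krylov:
  assumes "degree p < t"
  shows "combo (\<lambda>v. poly p (ev v) * (v \<bullet> b)) \<in> krylov A b t"
proof -
  have "combo (\<lambda>v. poly p (ev v) * (v \<bullet> b)) = (\<Sum>i\<le>degree p. coeff p i *\<^sub>R ((\<lambda>x. A *v x) ^^ i) b)"
    by (simp add: eq_iff_coords coord_combo inner_sum_right power_mult_coords poly_altdef
          sum_distrib_right mult.assoc)
  also have "\<dots> \<in> krylov A b t"
    unfolding krylov_def using assms by (intro span_sum span_scale span_base imageI) auto
  finally show ?thesis .
qed

text \<open>Since r(0) = 1, write r(z) = 1 + z q(z) with q of degree below \<open>t\<close>. With b
  = -(A + l I) y this gives (I - r(A + l I)) y = q(A + l I) b, a Krylov vector.\<close>

lemma combo_residual_in_krylov: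
  assumes r: "degree r \<le> t" "poly r 0 = 1" and "t \<ge> 1"
    and b: "\<And>v. v \<in> B \<Longrightarrow> v \<bullet> b = - (ev v + l) * (v \<bullet> y)"
  shows "combo (\<lambda>v. (1 - poly r (ev v + l)) * (v \<bullet> y)) \<in> krylov A b t"
proof -
  obtain a q where rq: "r = pCons a q" by (cases r)
  then have r': "poly r z = 1 + z * poly q z" for z using r(2) by simp
  have "degree q < t" using r(1) \<open>t \<ge> 1\<close> by (auto simp: rq split: if_splits)
  then have "degree (pcompose q [:l, 1:]) < t" by (simp add: degree_pcompose)
  moreover have "combo (\<lambda>v. (1 - poly r (ev v + l)) * (v \<bullet> y))
      = combo (\<lambda>v. poly (pcompose q [:l, 1:]) (ev v) * (v \<bullet> b))"
    unfolding eq_iff_coords by (auto simp: coord_combo r' b poly_pcompose algebra_simps)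
  ultimately show ?thesis using combo_poly_in_krylov by simp
qed

end

section \<open>Chebyshev polynomials\<close>

text \<open>Chebyshev polynomials of the first kind, by their three-term recurrence.\<close>

fun cos_poly :: "nat \<Rightarrow> real poly" where
  "cos_poly 0 = 1"
| "cos_poly (Suc 0) = [:0, 1:]"
| "cos_poly (Suc (Suc n)) = [:0, 2:] * cos_poly (Suc n) - cos_poly n"

text \<open>Odd Chebyshev polynomials with the root at 0 divided out:
  \<open>poly (sin_poly n)\<close> at s^2 is (-1)^n T_{2n+1}(s) / s. Using s^2 as the variable
  halves the degree.\<close>

fun sin_poly :: "nat \<Rightarrow> real poly" where
  "sin_poly 0 = 1"
| "sin_poly (Suc 0) = [:3, -4:]"
| "sin_poly (Suc (Suc n)) = [:2, -4:] * sin_poly (Suc n) - sin_poly n"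

lemma degree_three_term_le:
  fixes p q :: "real poly"
  assumes "degree p \<le> Suc n" "degree q \<le> n"
  shows "degree ([:a, c:] * p - q) \<le> Suc (Suc n)"
proof (rule degree_diff_le)
  have "degree ([:a, c:] * p) \<le> degree [:a, c:] + degree p" by (rule degree_mult_le)
  also have "\<dots> \<le> 1 + Suc n" using assms(1) by (intro add_mono) auto
  finally show "degree ([:a, c:] * p) \<le> Suc (Suc n)" by simp
qed (use assms in auto)

lemma degree_cos_poly_le: "degree (cos_poly n) \<le> n"
proof (induction n rule: cos_poly.induct)
  case (3 n)
  then show ?case by (simp only: cos_poly.simps degree_three_term_le)
qed auto

lemma degree_sin_poly_le: "degree (sin_poly n) \<le> n"
proof (induction n rule: sin_poly.induct)
  case (3 n)
  then show ?case by (simp only: sin_poly.simps degree_three_term_le)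
qed auto

lemma poly_cos_poly_cos: "poly (cos_poly n) (cos h) = cos (real n * h)"
proof (induction n rule: cos_poly.induct)
  case (3 n)
  have "cos (real (Suc (Suc n)) * h) = cos (real (Suc n) * h + h)" by (simp add: algebra_simps)
  moreover have "cos (real n * h) = cos (real (Suc n) * h - h)" by (simp add: algebra_simps)
  ultimately show ?case using 3 by (simp add: cos_add cos_diff del: of_nat_Suc)
qed auto

text \<open>The powers of \<open>w\<close> and of \<open>1 / w\<close> both satisfy the recurrence.
  This evaluates the polynomial outside [-1, 1], where the cosine formula gives nothing.\<close>

lemma poly_cos_poly_joukowski:
  assumes "w \<noteq> 0"
  shows "poly (cos_poly n) ((w + 1 / w) / 2) = (w ^ n + 1 / w ^ n) / 2"
proof (induction n rule: cos_poly.induct)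
  case (3 n)
  let ?j = "(w + 1 / w) / 2"
  have "poly (cos_poly (Suc (Suc n))) ?j = 2 * ?j * poly (cos_poly (Suc n)) ?j - poly (cos_poly n) ?j"
    by (simp add: mult.commute)
  also have "\<dots> = (w ^ Suc (Suc n) + 1 / w ^ Suc (Suc n)) / 2"
    unfolding 3 using assms by (simp add: field_simps)
  finally show ?case .
qed (auto simp: field_simps)

lemma sin_poly_sin: "sin h * poly (sin_poly n) ((sin h)\<^sup>2) = sin (real (2 * n + 1) * h)"
proof (induction n rule: sin_poly.induct)
  case 2
  have "sin (3 * h) = sin (2 * h + h)" by simp
  also have "\<dots> = 2 * sin h * (cos h)\<^sup>2 + (1 - 2 * (sin h)\<^sup>2) * sin h"
    by (subst sin_add, simp add: sin_double cos_double_sin power2_eq_square)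
  finally show ?case by (simp add: cos_squared_eq algebra_simps)
next
  case (3 n)
  define a where "a = real (2 * Suc n + 1) * h"
  have "sin (real (2 * Suc (Suc n) + 1) * h) + sin (real (2 * n + 1) * h) = sin (a + 2 * h) + sin (a - 2 * h)"
    by (simp add: a_def algebra_simps)
  also have "\<dots> = 2 * sin a * cos (2 * h)" by (simp add: sin_add sin_diff)
  also have "\<dots> = sin a * (2 - 4 * (sin h)\<^sup>2)" by (simp only: cos_double_sin) (simp add: algebra_simps)
  finally have "sin (real (2 * Suc (Suc n) + 1) * h) = (2 - 4 * (sin h)\<^sup>2) * sin a - sin (real (2 * n + 1) * h)"
    by (simp only: algebra_simps)
  also have "\<dots> = sin h * poly (sin_poly (Suc (Suc n))) ((sin h)\<^sup>2)"
    unfolding a_def 3[symmetric] by (simp add: algebra_simps)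
  finally show ?case by simp
qed auto

text \<open>The sine identity at an imaginary angle. It gives the values at negative arguments,
  where the polynomial grows exponentially in \<open>n\<close>.\<close>

lemma sin_poly_sinh: "sinh h * poly (sin_poly n) (- (sinh h)\<^sup>2) = sinh (real (2 * n + 1) * h)"
  for h :: real
proof (induction n rule: sin_poly.induct)
  case 2
  have "sinh (3 * h) = sinh (2 * h + h)" by simp
  also have "\<dots> = 2 * sinh h * (cosh h)\<^sup>2 + ((cosh h)\<^sup>2 + (sinh h)\<^sup>2) * sinh h"
    by (subst sinh_add, simp add: sinh_double cosh_double power2_eq_square)
  finally show ?case by (simp add: cosh_square_eq algebra_simps)
next
  case (3 n)
  define a where "a = real (2 * Suc n + 1) * h"
  have "sinh (real (2 * Suc (Suc n) + 1) * h) + sinh (real (2 * n + 1) * h) = sinh (a + 2 * h) + sinh (a - 2 * h)"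
    by (simp add: a_def algebra_simps)
  also have "\<dots> = 2 * sinh a * cosh (2 * h)" by (simp add: sinh_add sinh_diff)
  also have "\<dots> = sinh a * (2 + 4 * (sinh h)\<^sup>2)"
    by (simp only: cosh_double cosh_square_eq) (simp add: algebra_simps)
  finally have "sinh (real (2 * Suc (Suc n) + 1) * h) = (2 + 4 * (sinh h)\<^sup>2) * sinh a - sinh (real (2 * n + 1) * h)"
    by (simp only: algebra_simps)
  also have "\<dots> = sinh h * poly (sin_poly (Suc (Suc n))) (- (sinh h)\<^sup>2)"
    unfolding a_def 3[symmetric] by (simp add: algebra_simps)
  finally show ?case by simp
qed auto

lemma poly_sin_poly_0: "poly (sin_poly n) 0 = real (2 * n + 1)"
  by (induction n rule: sin_poly.induct) auto

section \<open>Bounds for Chebyshev polynomials and the residual polynomials built from them\<close>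

lemma abs_sin_nat_mult_le: "\<bar>sin (real n * h)\<bar> \<le> real n * \<bar>sin h\<bar>"
proof (induction n)
  case (Suc n)
  have "\<bar>sin (real (Suc n) * h)\<bar> = \<bar>sin (real n * h) * cos h + cos (real n * h) * sin h\<bar>"
    by (simp add: distrib_right sin_add algebra_simps)
  also have "\<dots> \<le> \<bar>sin (real n * h)\<bar> * \<bar>cos h\<bar> + \<bar>cos (real n * h)\<bar> * \<bar>sin h\<bar>"
    by (metis abs_mult abs_triangle_ineq)
  also have "\<dots> \<le> \<bar>sin (real n * h)\<bar> * 1 + 1 * \<bar>sin h\<bar>"
    by (intro add_mono mult_left_mono mult_right_mono) auto
  finally show ?case using Suc by (simp add: algebra_simps)
qed auto

lemma abs_cos_poly_le_1: "\<bar>x\<bar> \<le> 1 \<Longrightarrow> \<bar>poly (cos_poly n) x\<bar> \<le> 1"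
  using poly_cos_poly_cos[of n "arccos x"] by (simp add: cos_arccos_abs)

text \<open>Substitute \<open>u\<close> = sin^2 h. The first bound is that a sine is at most 1 in
  absolute value, the second is \<open>abs_sin_nat_mult_le\<close>.\<close>

lemma sin_poly_bounds:
  assumes "0 \<le> u" "u \<le> 1"
  shows "u * (poly (sin_poly n) u)\<^sup>2 \<le> 1" "\<bar>poly (sin_poly n) u\<bar> \<le> real (2 * n + 1)"
proof -
  define h where "h = arcsin (sqrt u)"
  have "sqrt u \<le> 1" using assms by simp
  then have h: "sin h = sqrt u" unfolding h_def
    using assms by (intro sin_arcsin) (auto intro: order_trans[of _ 0])
  then have e: "sqrt u * poly (sin_poly n) u = sin (real (2 * n + 1) * h)"
    using sin_poly_sin[of h n] assms by simp
  have "u * (poly (sin_poly n) u)\<^sup>2 = (sin (real (2 * n + 1) * h))\<^sup>2"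
    unfolding e[symmetric] using assms by (simp add: power_mult_distrib)
  then show "u * (poly (sin_poly n) u)\<^sup>2 \<le> 1" by (simp add: abs_square_le_1)
  show "\<bar>poly (sin_poly n) u\<bar> \<le> real (2 * n + 1)"
  proof (cases "u = 0")
    case False
    then have "sqrt u * \<bar>poly (sin_poly n) u\<bar> = \<bar>sin (real (2 * n + 1) * h)\<bar>"
      unfolding e[symmetric] using assms by (simp add: abs_mult)
    also have "\<dots> \<le> sqrt u * real (2 * n + 1)"
      using abs_sin_nat_mult_le[of "2 * n + 1" h] h assms by (simp add: mult.commute)
    finally show ?thesis using False assms by simp
  qed (simp add: poly_sin_poly_0)
qed

text \<open>Equivalent to \<open>x \<le> artanh x\<close>. The function (1 + x) exp(-2x) + x equals
  1 at 0, and its derivative is nonnegative because 1 + 2y is at most exp(2y).\<close>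

lemma exp_double_le:
  fixes x :: real
  assumes "0 \<le> x" "x < 1"
  shows "exp (2 * x) * (1 - x) \<le> 1 + x"
proof -
  let ?g = "\<lambda>x. (1 + x) * exp (- 2 * x) + x"
  have "?g 0 \<le> ?g x"
  proof (rule DERIV_nonneg_imp_nondecreasing[OF assms(1)])
    fix y :: real assume y: "0 \<le> y" "y \<le> x"
    have "exp (- 2 * y) * (1 + 2 * y) \<le> exp (- 2 * y) * exp (2 * y)"
      by (intro mult_left_mono) auto
    then have "0 \<le> exp (- 2 * y) * (1 + (1 + y) * (- 2)) + 1"
      by (simp add: algebra_simps flip: exp_add)
    moreover have "(?g has_real_derivative (exp (- 2 * y) * (1 + (1 + y) * (- 2)) + 1)) (at y)"
      by (auto intro!: derivative_eq_intros simp: algebra_simps)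
    ultimately show "\<exists>d. (?g has_real_derivative d) (at y) \<and> 0 \<le> d" by blast
  qed
  then have "(1 - x) \<le> (1 + x) * exp (- 2 * x)" by simp
  then have "exp (2 * x) * (1 - x) \<le> exp (2 * x) * ((1 + x) * exp (- 2 * x))"
    by (intro mult_left_mono) auto
  also have "\<dots> = 1 + x" by (simp add: exp_minus field_simps)
  finally show ?thesis .
qed

text \<open>The Chebyshev polynomial for $[\mu, L]$, normalised at $0$; with $w = (1 + x)/(1 - x)$ and
  $x = \sqrt{\mu/L}$, the normalising value is the Joukowski image $(w^t + w^{-t})/2$.\<close>

lemma chebyshev_residual:
  assumes "0 < m" "m \<le> L" "t \<ge> 1"
  obtains r where "degree r \<le> t" "poly r 0 = 1"
    "\<And>z. m \<le> z \<Longrightarrow> z \<le> L \<Longrightarrow> \<bar>poly r z\<bar> \<le> 2 * exp (- 2 * real t * sqrt (m / L))"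
proof (cases "m = L")
  case True
  \<comment> \<open>The affine map onto [-1, 1] degenerates when \<open>m = L\<close>; here the
    power vanishes at the only point of the interval, as \<open>t\<close> is positive.\<close>
  have "degree ([:1, - 1 / L:] ^ t) \<le> degree [:1, - 1 / L:] * t" by (rule degree_power_le)
  then have "degree ([:1, - 1 / L:] ^ t) \<le> t" using assms by simp
  then show ?thesis
    using assms True by (intro that[of "[:1, - 1 / L:] ^ t"]) (auto simp: poly_power power_0_left)
next
  case False
  define x where "x = sqrt (m / L)"
  have x: "0 < x" "x < 1" "x\<^sup>2 = m / L" using assms False by (auto simp: x_def)
  define w where "w = (1 + x) / (1 - x)"
  have w: "w > 0" using x by (simp add: w_def)
  have e: "exp (2 * x) \<le> w" using exp_double_le[of x] x by (simp add: w_def field_simps)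
  define c where "c = poly (cos_poly t) ((L + m) / (L - m))"
  have "(w + 1 / w) / 2 = (1 + x\<^sup>2) / (1 - x\<^sup>2)"
  proof -
    have ne: "1 + x \<noteq> 0" "1 - x \<noteq> 0" "(1 - x) * (1 + x) = 1 - x\<^sup>2"
      using x(1,2) by (auto simp: power2_eq_square algebra_simps)
    then have "w + 1 / w = ((1 + x)\<^sup>2 + (1 - x)\<^sup>2) / ((1 - x) * (1 + x))"
      by (simp add: w_def add_frac_eq power2_eq_square)
    also have "(1 + x)\<^sup>2 + (1 - x)\<^sup>2 = 2 * (1 + x\<^sup>2)" by (simp add: power2_eq_square algebra_simps)
    finally have "w + 1 / w = 2 * ((1 + x\<^sup>2) / (1 - x\<^sup>2))" unfolding ne(3) by simp
    moreover have "c / 2 = d" if "c = 2 * d" for c d :: real using that by simp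
    ultimately show ?thesis by blast
  qed
  also have "1 + x\<^sup>2 = (L + m) / L"
    using assms x(3) by (simp add: add_divide_distrib)
  also have "1 - x\<^sup>2 = (L - m) / L"
    using assms x(3) by (simp add: diff_divide_distrib)
  also have "(L + m) / L / ((L - m) / L) = (L + m) / (L - m)" using assms by simp
  finally have "c = poly (cos_poly t) ((w + 1 / w) / 2)" unfolding c_def by (simp only:)
  also have "\<dots> = (w ^ t + 1 / w ^ t) / 2" using w by (intro poly_cos_poly_joukowski) simp
  finally have "c = (w ^ t + 1 / w ^ t) / 2" .
  moreover have "exp (2 * x) ^ t \<le> w ^ t" using e by (intro power_mono) auto
  then have "exp (2 * real t * x) \<le> w ^ t" by (simp flip: exp_of_nat_mult add: mult_ac)
  moreover have "0 < 1 / w ^ t" using w by simp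
  ultimately have "w ^ t / 2 \<le> c" "exp (2 * real t * x) \<le> w ^ t" by simp_all
  then have c: "exp (2 * real t * x) / 2 \<le> c" by linarith
  then have "c > 0" using less_le_trans[of 0 "exp (2 * real t * x) / 2" c] by simp
  \<comment> \<open>The inner affine map sends \<open>m\<close> to 1, \<open>L\<close> to -1 and 0
    to the point where \<open>c\<close> was evaluated.\<close>
  define r where "r = smult (1 / c) (pcompose (cos_poly t) [:(L + m) / (L - m), - 2 / (L - m):])"
  have "degree r \<le> degree (pcompose (cos_poly t) [:(L + m) / (L - m), - 2 / (L - m):])"
    unfolding r_def by (rule degree_smult_le)
  also have "\<dots> \<le> t" using degree_cos_poly_le[of t] by (simp add: degree_pcompose)
  finally have "degree r \<le> t" .
  moreover have "poly r 0 = 1" using \<open>c > 0\<close> by (simp add: r_def poly_pcompose c_def)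
  moreover have "\<bar>poly r z\<bar> \<le> 2 * exp (- 2 * real t * sqrt (m / L))" if "m \<le> z" "z \<le> L" for z
  proof -
    have "\<bar>(L + m) / (L - m) + z * (- 2 / (L - m))\<bar> = \<bar>(L + m - 2 * z) / (L - m)\<bar>"
      by (simp add: diff_divide_distrib add_divide_distrib mult.commute)
    also have "\<dots> \<le> 1" using that assms False by (simp add: abs_divide divide_le_eq abs_le_iff)
    finally have "\<bar>poly r z\<bar> \<le> 1 / c"
      using abs_cos_poly_le_1[of "(L + m) / (L - m) + z * (- 2 / (L - m))" t] \<open>c > 0\<close>
      by (simp add: r_def poly_pcompose abs_mult divide_right_mono)
    also have "\<dots> \<le> 1 / (exp (2 * real t * x) / 2)" using c \<open>c > 0\<close> by (intro divide_left_mono) auto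
    also have "\<dots> = 2 * exp (- 2 * real t * x)" by (simp add: exp_minus field_simps)
    finally show ?thesis unfolding x_def .
  qed
  ultimately show ?thesis by (rule that)
qed

text \<open>Two regimes, with \<open>L = m + D\<close>. If \<open>m\<close> is at most
  \<open>3 * D\<close>, then \<open>L\<close> is at most \<open>4 * D\<close> and a squared
  Chebyshev polynomial on [0, L] suffices. Otherwise the interval is short relative to
  \<open>L\<close>, and (1 - z/L)^t decays geometrically with ratio at most 1/4.\<close>

lemma sublinear_residual:
  assumes "0 \<le> m" "0 \<le> D" "t \<ge> 1"
  obtains r where "degree r \<le> t" "poly r 0 = 1"
    "\<And>z. m \<le> z \<Longrightarrow> z \<le> m + D \<Longrightarrow>
      0 \<le> poly r z \<and> poly r z \<le> 1 \<and> z * poly r z \<le> 4 * D / (real t - 1/2)\<^sup>2"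
proof -
  define L where "L = m + D"
  have t: "0 < real t - 1/2" using assms(3) by (simp add: field_simps)
  consider "L = 0" | "L > 0" "m \<le> 3 * D" | "L > 0" "m > 3 * D"
    using assms L_def by linarith
  then show ?thesis
  proof cases
    case 1
    then have "m = 0" "D = 0" using assms by (auto simp: L_def)
    then show ?thesis by (intro that[of 1]) auto
  next
    case 2
    \<comment> \<open>With this \<open>k\<close> the square of a polynomial of degree
      \<open>k\<close> has degree at most \<open>t\<close>, while \<open>2 * k + 1\<close> is still
      at least \<open>t\<close>. Squaring makes the residual nonnegative.\<close>
    define k where "k = t div 2"
    define q where "q = pcompose (sin_poly k) [:0, 1 / L:]"
    define r where "r = smult (1 / (real (2 * k + 1))\<^sup>2) (q ^ 2)"
    have r: "poly r z = (poly (sin_poly k) (z / L) / real (2 * k + 1))\<^sup>2" for z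
      by (simp add: r_def q_def poly_power poly_pcompose power_divide)
    have "degree q \<le> k" using degree_sin_poly_le[of k] by (simp add: q_def degree_pcompose)
    then have "degree (q ^ 2) \<le> 2 * k"
      using degree_power_le[of q 2] by linarith
    then have "degree r \<le> t" unfolding r_def k_def
      by (meson degree_smult_le order_trans times_div_less_eq_dividend)
    moreover have "poly r 0 = 1" by (simp add: r poly_sin_poly_0 del: of_nat_add of_nat_mult)
    moreover have "0 \<le> poly r z \<and> poly r z \<le> 1 \<and> z * poly r z \<le> 4 * D / (real t - 1/2)\<^sup>2"
      if "m \<le> z" "z \<le> m + D" for z
    proof -
      have u: "0 \<le> z / L" "z / L \<le> 1" using that assms 2 by (auto simp: L_def)
      note b = sin_poly_bounds[OF u, of k]
      have r1: "poly r z \<le> 1" unfolding r using b(2) by (simp add: abs_square_le_1 del: of_nat_add of_nat_mult)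
      have "t \<le> 2 * k + 1" by (simp add: k_def)
      then have kt: "real t - 1/2 \<le> real (2 * k + 1)" by linarith
      have "z * poly r z = L * (z / L * (poly (sin_poly k) (z / L))\<^sup>2) / (real (2 * k + 1))\<^sup>2"
        using 2 by (simp add: r power_divide)
      also have "\<dots> \<le> L * 1 / (real (2 * k + 1))\<^sup>2"
        using 2 b(1) by (intro divide_right_mono mult_left_mono) auto
      also have "\<dots> \<le> L * 1 / (real t - 1/2)\<^sup>2"
        using 2 t kt by (intro divide_left_mono power_mono mult_pos_pos zero_less_power) auto
      also have "\<dots> \<le> 4 * D / (real t - 1/2)\<^sup>2" using 2 by (intro divide_right_mono) (auto simp: L_def)
      finally show ?thesis using r1 by (simp add: r)
    qed
    ultimately show ?thesis by (rule that)
  next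
    case 3
    define r where "r = [:1, - 1 / L:] ^ t"
    have r: "poly r z = (1 - z / L) ^ t" for z by (simp add: r_def poly_power)
    have "degree r \<le> degree [:1, - 1 / L:] * t" unfolding r_def by (rule degree_power_le)
    then have "degree r \<le> t" using 3 by simp
    moreover have "poly r 0 = 1" by (simp add: r)
    moreover have "0 \<le> poly r z \<and> poly r z \<le> 1 \<and> z * poly r z \<le> 4 * D / (real t - 1/2)\<^sup>2"
      if z: "m \<le> z" "z \<le> m + D" for z
    proof -
      have u: "0 \<le> 1 - z / L" "1 - z / L \<le> 1" "1 - z / L \<le> D / L"
        using z assms 3 by (auto simp: L_def divide_le_eq diff_le_eq simp flip: add_divide_distrib)
      have D4: "D / L \<le> 1 / 4" using 3 by (simp add: L_def field_simps)
      have zL: "z \<le> L" "0 \<le> z" using z assms by (auto simp: L_def)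
      \<comment> \<open>One factor \<open>D / L\<close> cancels the leading \<open>L\<close>,
        leaving the exponent \<open>s = t - 1\<close>; then t < 2^t converts the geometric decay
        into the quadratic one with the constant 4.\<close>
      obtain s where s: "t = Suc s" using assms(3) by (cases t) auto
      have p: "real t - 1/2 \<le> 2 * 2 ^ s"
        using of_nat_less_two_power[of t, where 'a = real] by (simp add: s)
      then have "(real t - 1/2)\<^sup>2 \<le> (2 * 2 ^ s)\<^sup>2" using t by (intro power_mono) auto
      also have "\<dots> = 4 * 4 ^ s" by (simp add: power_mult_distrib power2_eq_square flip: power_mult_distrib)
      finally have q: "(real t - 1/2)\<^sup>2 \<le> 4 * 4 ^ s" .
      have "z * poly r z \<le> L * (D / L) ^ t"
        unfolding r using zL u by (intro mult_mono power_mono) auto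
      also have "\<dots> = D * (D / L) ^ s" using 3 by (simp add: s)
      also have "\<dots> \<le> D * (1 / 4) ^ s" using D4 assms 3 by (intro mult_left_mono power_mono) auto
      also have "\<dots> = 4 * D / (4 * 4 ^ s)" by (simp add: power_divide)
      also have "\<dots> \<le> 4 * D / (real t - 1/2)\<^sup>2"
        using q assms t by (intro divide_left_mono mult_pos_pos zero_less_power) auto
      finally show ?thesis using u by (auto simp: r power_le_one)
    qed
    ultimately show ?thesis by (rule that)
  qed
qed

text \<open>The polynomial used by Kuczy\'nski and Wo\'zniakowski to bound the Lanczos estimate of the
  least eigenvalue.\<close>

lemma lanczos_polynomial:
  fixes e c :: real
  assumes "0 < e" "e < 1" "exp (2 * real (2 * k + 1) * sqrt e) \<ge> 4 * c" "c > 0"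
  obtains p where "degree p \<le> k" "poly p 0 > 0" "e * (poly p 0)\<^sup>2 \<ge> (1 - e) * (c - 1)"
    "\<And>u. e \<le> u \<Longrightarrow> u \<le> 1 \<Longrightarrow> (u - e) * (poly p u)\<^sup>2 \<le> 1 - e"
proof -
  \<comment> \<open>The affine map in \<open>p\<close> takes [e, 1] onto [0, 1] and 0 to
    \<open>- e / (1 - e)\<close>. This choice of \<open>h\<close> makes that value equal to minus
    the square of \<open>sinh h\<close>, so \<open>poly p 0\<close> is a quotient of hyperbolic
    sines.\<close>
  define h where "h = artanh (sqrt e)"
  define n where "n = real (2 * k + 1)"
  define p where "p = pcompose (sin_poly k) [:- e / (1 - e), 1 / (1 - e):]"
  have s: "0 < sqrt e" "sqrt e < 1" using assms by auto
  have eh: "exp (2 * h) = (1 + sqrt e) / (1 - sqrt e)"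
  proof -
    have "0 < (1 + sqrt e) / (1 - sqrt e)" using s by (intro divide_pos_pos) linarith+
    then show ?thesis by (simp add: h_def artanh_def)
  qed
  have "exp (2 * sqrt e) \<le> exp (2 * h)"
    using exp_double_le[of "sqrt e"] s unfolding eh by (subst pos_le_divide_eq) linarith+
  then have h: "sqrt e \<le> h" by simp
  have "h > 0" using h s by linarith
  have "n > 0" by (simp add: n_def)
  have "exp (- 2 * h) = (1 - sqrt e) / (1 + sqrt e)" by (simp add: exp_minus eh)
  moreover have "1 + sqrt e \<noteq> 0" using s by linarith
  then have "1 - (1 - sqrt e) / (1 + sqrt e) = 2 * sqrt e / (1 + sqrt e)"
    "1 + (1 - sqrt e) / (1 + sqrt e) = 2 / (1 + sqrt e)"
    by (simp_all add: field_simps)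
  ultimately have th: "tanh h = sqrt e"
    using \<open>1 + sqrt e \<noteq> 0\<close> by (simp add: tanh_real_altdef)
  have "(sinh h)\<^sup>2 = e * (cosh h)\<^sup>2" using th assms cosh_real_pos[of h]
    by (simp add: tanh_def field_simps power_mult_distrib)
  then have sh: "(sinh h)\<^sup>2 = e / (1 - e)" using assms by (simp add: cosh_square_eq field_simps)
  have "sinh h > 0" using \<open>h > 0\<close> by simp
  have p0: "sinh h * poly p 0 = sinh (n * h)"
    using sin_poly_sinh[of h k] by (simp add: p_def poly_pcompose sh n_def)
  have "0 < sinh (n * h)" using \<open>h > 0\<close> \<open>n > 0\<close> by simp
  then have "poly p 0 > 0" using p0 \<open>sinh h > 0\<close> zero_less_mult_pos by metis
  moreover have "degree p \<le> k" using degree_sin_poly_le[of k] by (simp add: p_def degree_pcompose)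
  moreover have "e * (poly p 0)\<^sup>2 \<ge> (1 - e) * (c - 1)"
  proof -
    have "4 * c \<le> exp (2 * (n * h))"
    proof (rule order_trans[OF assms(3)])
      show "exp (2 * real (2 * k + 1) * sqrt e) \<le> exp (2 * (n * h))"
        using mult_left_mono[OF h, of n] \<open>n > 0\<close> unfolding n_def[symmetric] by simp
    qed
    also have "\<dots> = (exp (n * h))\<^sup>2" by (simp add: power2_eq_square flip: exp_add)
    also have "\<dots> \<le> (2 * cosh (n * h))\<^sup>2"
      by (intro power_mono) (auto simp: cosh_def)
    finally have "c - 1 \<le> (sinh (n * h))\<^sup>2" by (simp add: cosh_square_eq power_mult_distrib)
    also have "\<dots> = e / (1 - e) * (poly p 0)\<^sup>2" by (simp flip: p0 sh add: power_mult_distrib)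
    finally show ?thesis using assms by (simp add: field_simps)
  qed
  moreover have "(u - e) * (poly p u)\<^sup>2 \<le> 1 - e" if "e \<le> u" "u \<le> 1" for u
  proof -
    define v where "v = (u - e) / (1 - e)"
    have v: "0 \<le> v" "v \<le> 1" using that assms by (auto simp: v_def)
    have "poly p u = poly (sin_poly k) v"
      by (simp add: p_def poly_pcompose v_def diff_divide_distrib)
    moreover have "u - e = (1 - e) * v" using assms by (simp add: v_def)
    ultimately have "(u - e) * (poly p u)\<^sup>2 = (1 - e) * (v * (poly (sin_poly k) v)\<^sup>2)" by simp
    also have "\<dots> \<le> (1 - e) * 1" using assms sin_poly_bounds(1)[OF v] by (intro mult_left_mono) auto
    finally show ?thesis by simp
  qed
  ultimately show ?thesis by (intro that)
qed

section \<open>The Lanczos vector\<close>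

context eigenbasis
begin

lemma selfadjoint: "x \<bullet> (A *v y) = (A *v x) \<bullet> y"
  unfolding inner_coords[of x] inner_coords[of "A *v x"]
  by (intro sum.cong) (auto simp: coord_mult)

lemma norm_le_if_coords_le:
  assumes "\<And>v. v \<in> B \<Longrightarrow> \<bar>v \<bullet> x\<bar> \<le> k * \<bar>v \<bullet> y\<bar>" "0 \<le> k"
  shows "norm x \<le> k * norm y"
proof -
  have "(norm x)\<^sup>2 \<le> (\<Sum>v\<in>B. k\<^sup>2 * (v \<bullet> y)\<^sup>2)"
    unfolding norm_sq_coords
  proof (rule sum_mono)
    fix v assume "v \<in> B"
    then have "\<bar>v \<bullet> x\<bar>\<^sup>2 \<le> (k * \<bar>v \<bullet> y\<bar>)\<^sup>2" using assms by (intro power_mono) auto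
    then show "(v \<bullet> x)\<^sup>2 \<le> k\<^sup>2 * (v \<bullet> y)\<^sup>2" by (simp add: power_mult_distrib)
  qed
  also have "\<dots> = (k * norm y)\<^sup>2"
    unfolding power_mult_distrib norm_sq_coords by (simp add: sum_distrib_left)
  finally show ?thesis by (rule power2_le_imp_le) (simp add: assms)
qed

lemma shifted_form_coords: "x \<bullet> (A *v x) - a * (x \<bullet> x) = (\<Sum>v\<in>B. (ev v - a) * (v \<bullet> x)\<^sup>2)"
  unfolding quadratic_form_coords inner_coords[of x x]
  by (simp add: sum_distrib_left sum_subtractf power2_eq_square algebra_simps)

text \<open>Take \<open>z\<close> to be the normalized q(A) b, with q the polynomial above on the
  spectrum rescaled to [0, 1]. Relative to the level \<open>ev u + D * e\<close>, the other
  coordinates contribute at most \<open>D * (1 - e)\<close> times their weight in \<open>b\<close>;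
  the coordinate along \<open>u\<close> contributes negatively and outweighs them because
  \<open>poly p 0\<close> is large.\<close>

lemma lanczos_vector:
  assumes u: "u \<in> B" "u \<bullet> b \<noteq> 0" and ev: "\<And>v. v \<in> B \<Longrightarrow> ev u \<le> ev v \<and> ev v \<le> ev u + D"
    and "t \<ge> 1"
  obtains z where "z \<in> krylov A b t" "norm z = 1"
    "z \<bullet> (A *v z) - ev u * (z \<bullet> z)
      \<le> D * (ln (4 * (norm b)\<^sup>2 / (u \<bullet> b)\<^sup>2))\<^sup>2 / (16 * (real t - 1/2)\<^sup>2)"
proof -
  \<comment> \<open>Krylov degrees stay below \<open>t\<close>, and \<open>2 * k + 1\<close> is
    twice \<open>t - 1/2\<close>: this is the source of the shift by one half.\<close>
  define k where "k = t - 1"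
  define c where "c = (norm b)\<^sup>2 / (u \<bullet> b)\<^sup>2"
  \<comment> \<open>Chosen so that the exponential condition on the polynomial holds with equality;
    the claimed bound is then exactly \<open>D * e\<close>.\<close>
  define e where "e = (ln (4 * c) / (2 * real (2 * k + 1)))\<^sup>2"
  have b0: "norm b > 0" using u by auto
  have "\<bar>u \<bullet> b\<bar> \<le> norm b" using Cauchy_Schwarz_ineq2[of u b] norm_basis[OF u(1)] by simp
  then have "(u \<bullet> b)\<^sup>2 \<le> (norm b)\<^sup>2" using power_mono[of "\<bar>u \<bullet> b\<bar>" "norm b" 2] by simp
  then have c1: "c \<ge> 1" using u by (simp add: c_def)
  have D0: "D \<ge> 0" using ev[OF u(1)] by simp
  have t: "real (2 * k + 1) = 2 * (real t - 1/2)" using \<open>t \<ge> 1\<close> by (simp add: k_def of_nat_diff)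
  have De: "D * (ln (4 * (norm b)\<^sup>2 / (u \<bullet> b)\<^sup>2))\<^sup>2 / (16 * (real t - 1/2)\<^sup>2) = D * e"
  proof -
    have "D * a\<^sup>2 / (16 * y\<^sup>2) = D * (a / (2 * (2 * y)))\<^sup>2" for a y :: real
      by (simp add: power_divide power_mult_distrib)
    then show ?thesis unfolding e_def t by (simp only: c_def times_divide_eq_right)
  qed
  consider "D = 0 \<or> e \<ge> 1" | "D > 0" "e < 1" using D0 by linarith
  then show ?thesis
  proof cases
    \<comment> \<open>The bound is at least the whole spread \<open>D\<close> of the spectrum, so
      the normalized \<open>b\<close> already satisfies it.\<close>
    case 1
    let ?z = "b /\<^sub>R norm b"
    have "((\<lambda>v. A *v v) ^^ 0) b \<in> krylov A b t"
      unfolding krylov_def using \<open>t \<ge> 1\<close> by (intro span_base imageI) auto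
    then have "?z \<in> krylov A b t" unfolding krylov_def by (auto intro: span_scale)
    moreover have nz: "norm ?z = 1" using b0 by simp
    moreover have "?z \<bullet> (A *v ?z) - ev u * (?z \<bullet> ?z) \<le> (\<Sum>v\<in>B. D * (v \<bullet> ?z)\<^sup>2)"
      unfolding shifted_form_coords using ev
      by (intro sum_mono mult_right_mono) (auto simp: diff_le_eq add.commute)
    then have "?z \<bullet> (A *v ?z) - ev u * (?z \<bullet> ?z) \<le> D"
      using norm_sq_coords[of ?z] nz by (simp flip: sum_distrib_left)
    moreover have "D \<le> D * e" using 1 D0 mult_left_mono[of 1 e D] by auto
    ultimately show ?thesis unfolding De[symmetric] by (intro that[of ?z]) linarith+
  next
    case 2
    have ln0: "ln (4 * c) > 0" using c1 by simp
    then have "e > 0" by (simp add: e_def)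
    have se: "sqrt e = ln (4 * c) / (2 * real (2 * k + 1))" using ln0 by (simp add: e_def)
    have "2 * real (2 * k + 1) * sqrt e = ln (4 * c)" unfolding se by (simp del: of_nat_add of_nat_mult)
    then have "exp (2 * real (2 * k + 1) * sqrt e) = 4 * c" using c1 by simp
    then obtain p where p: "degree p \<le> k" "poly p 0 > 0" "e * (poly p 0)\<^sup>2 \<ge> (1 - e) * (c - 1)"
      "\<And>s. e \<le> s \<Longrightarrow> s \<le> 1 \<Longrightarrow> (s - e) * (poly p s)\<^sup>2 \<le> 1 - e"
      using lanczos_polynomial[where e = e and k = k and c = c] \<open>e > 0\<close> 2 c1 by auto
    define q where "q = pcompose p [:- ev u / D, 1 / D:]"
    have q: "poly q s = poly p ((s - ev u) / D)" for s
      by (simp add: q_def poly_pcompose diff_divide_distrib)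
    have "degree q \<le> k" using p(1) by (simp add: q_def degree_pcompose)
    then have "degree q < t" using \<open>t \<ge> 1\<close> unfolding k_def by linarith
    define y where "y = combo (\<lambda>v. poly q (ev v) * (v \<bullet> b))"
    have yK: "y \<in> krylov A b t" unfolding y_def by (rule combo_poly_in_krylov) fact
    have yc: "v \<bullet> y = poly q (ev v) * (v \<bullet> b)" if "v \<in> B" for v
      using that by (simp add: y_def coord_combo)
    have "u \<bullet> y \<noteq> 0" using u p(2) by (simp add: yc q)
    then have y0: "norm y > 0" by auto
    have rest: "(ev v - ev u - D * e) * (v \<bullet> y)\<^sup>2 \<le> D * (1 - e) * (v \<bullet> b)\<^sup>2" if v: "v \<in> B" for v
    proof -
      define s where "s = (ev v - ev u) / D"
      have s: "s \<le> 1" using ev[OF v] 2 by (simp add: s_def divide_le_eq)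
      have "(s - e) * (poly p s)\<^sup>2 \<le> 1 - e"
      \<comment> \<open>Below \<open>e\<close> the left-hand side is nonpositive, so the polynomial
        estimate is needed only on [e, 1].\<close>
      proof (cases "e \<le> s")
        case False
        then have "(s - e) * (poly p s)\<^sup>2 \<le> 0" by (intro mult_nonpos_nonneg) auto
        then show ?thesis using 2 by simp
      qed (use s p(4) in blast)
      then have "(s - e) * (poly p s)\<^sup>2 * (D * (v \<bullet> b)\<^sup>2) \<le> (1 - e) * (D * (v \<bullet> b)\<^sup>2)"
        using D0 by (intro mult_right_mono) auto
      moreover have "ev v - ev u - D * e = D * (s - e)" using 2 by (simp add: s_def field_simps)
      ultimately show ?thesis using v by (simp add: yc q s_def[symmetric] power_mult_distrib mult_ac)
    qed
    have bsum: "(\<Sum>v\<in>B - {u}. (v \<bullet> b)\<^sup>2) = (c - 1) * (u \<bullet> b)\<^sup>2"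
      using sum.remove[OF finite_basis u(1), of "\<lambda>v. (v \<bullet> b)\<^sup>2"] u(2) norm_sq_coords[of b]
      by (simp add: c_def left_diff_distrib)
    have "y \<bullet> (A *v y) - (ev u + D * e) * (y \<bullet> y)
        = - (D * e) * (u \<bullet> y)\<^sup>2 + (\<Sum>v\<in>B - {u}. (ev v - ev u - D * e) * (v \<bullet> y)\<^sup>2)"
      unfolding shifted_form_coords
      by (subst sum.remove[OF finite_basis u(1)]) (simp add: algebra_simps)
    also have "\<dots> \<le> - (D * e) * (u \<bullet> y)\<^sup>2 + (\<Sum>v\<in>B - {u}. D * (1 - e) * (v \<bullet> b)\<^sup>2)"
      using rest by (intro add_left_mono sum_mono) auto
    also have "\<dots> = D * (u \<bullet> b)\<^sup>2 * ((1 - e) * (c - 1) - e * (poly p 0)\<^sup>2)"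
      unfolding sum_distrib_left[symmetric] bsum
      using u by (simp add: yc q power_mult_distrib algebra_simps)
    also have "\<dots> \<le> 0" using p(3) D0 by (intro mult_nonneg_nonpos) auto
    finally have ry: "y \<bullet> (A *v y) - ev u * (y \<bullet> y) \<le> D * e * (norm y)\<^sup>2"
      by (simp add: power2_norm_eq_inner algebra_simps)
    let ?z = "y /\<^sub>R norm y"
    have "?z \<in> krylov A b t" using yK unfolding krylov_def by (rule span_scale)
    moreover have "norm ?z = 1" using y0 by simp
    moreover have "?z \<bullet> (A *v ?z) - ev u * (?z \<bullet> ?z) = (y \<bullet> (A *v y) - ev u * (y \<bullet> y)) / (norm y)\<^sup>2"
      by (simp add: linear_scale[OF matrix_vector_mul_linear] diff_divide_distrib power2_eq_square
          divide_inverse algebra_simps)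
    moreover have "\<dots> \<le> D * e" using ry y0 by (simp add: divide_le_eq)
    ultimately show ?thesis unfolding De[symmetric] by (intro that[of ?z]) linarith+
  qed
qed

end

section \<open>Krylov approximations of the cubic minimizer\<close>

locale cubic_minimizer = eigenbasis A B ev
  for A :: "real ^ 'n ^ 'n" and B ev +
  fixes b :: "real ^ 'n" and \<rho> :: real and xs :: "real ^ 'n"
  assumes rho_nonneg: "\<rho> \<ge> 0"
    and minimal: "cubic_objective A b \<rho> xs \<le> cubic_objective A b \<rho> y"
begin

definition "shift = \<rho> * norm xs"

lemma shift_nonneg: "shift \<ge> 0"
  using rho_nonneg by (simp add: shift_def)

text \<open>The cubic term is expanded so that its remainder vanishes on the sphere through the minimizer.\<close>

lemma objective_expansion:
  "cubic_objective A b \<rho> (xs + s) - cubic_objective A b \<rho> xs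
    = (s \<bullet> (A *v s) + shift * (s \<bullet> s)) / 2 + (A *v xs + shift *\<^sub>R xs + b) \<bullet> s
      + \<rho> / 6 * (norm xs - norm (xs + s))\<^sup>2 * (norm xs + 2 * norm (xs + s))"
proof -
  define R N where "R = norm xs" and "N = norm (xs + s)"
  have "(xs + s) \<bullet> (A *v (xs + s)) = xs \<bullet> (A *v xs) + 2 * ((A *v xs) \<bullet> s) + s \<bullet> (A *v s)"
    using selfadjoint[of xs s]
    by (simp add: matrix_vector_right_distrib inner_add_left inner_add_right inner_commute)
  moreover have "shift * (xs \<bullet> s) + shift * (s \<bullet> s) / 2 = \<rho> * R * (N\<^sup>2 - R\<^sup>2) / 2"
    unfolding R_def N_def shift_def power2_norm_eq_inner
    by (simp add: inner_add_left inner_add_right inner_commute algebra_simps)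
  moreover have "\<rho> / 3 * N ^ 3 - \<rho> / 3 * R ^ 3
      = \<rho> * R * (N\<^sup>2 - R\<^sup>2) / 2 + \<rho> / 6 * (R - N)\<^sup>2 * (R + 2 * N)"
    by (simp add: power2_eq_square power3_eq_cube field_simps)
  moreover have "(1/2) * X' + (bx + bs) + N' - ((1/2) * X + bx + R')
      = (Q + shift * ss) / 2 + (P + shift * p + bs) + rem"
    if "X' = X + 2 * P + Q" "shift * p + shift * ss / 2 = M" "N' - R' = M + rem"
    for X' X P Q p ss M N' R' rem bx bs :: real
    using that by simp argo
  ultimately show ?thesis
    unfolding cubic_objective_def R_def[symmetric] N_def[symmetric] inner_add_right[of b]
      inner_add_left[of "A *v xs + shift *\<^sub>R xs"] inner_add_left[of "A *v xs"] inner_scaleR_left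
    by blast
qed

text \<open>Test minimality at \<open>xs\<close> minus \<open>t\<close> times the gradient
  \<open>g\<close>. By the reverse triangle inequality the norm changes by at most
  \<open>t * norm g\<close>, so everything beyond the linear term is quadratic in \<open>t\<close>
  and \<open>g \<bullet> g \<le> 0\<close> follows. The norm is never differentiated, so
  \<open>xs = 0\<close> needs no separate treatment.\<close>

lemma stationary: "A *v xs + shift *\<^sub>R xs + b = 0"
proof -
  define g where "g = A *v xs + shift *\<^sub>R xs + b"
  define c where "c = (g \<bullet> (A *v g) + shift * (g \<bullet> g)) / 2
    + \<rho> / 6 * (norm g)\<^sup>2 * (3 * norm xs + 2 * norm g)"
  have "g \<bullet> g \<le> 0"
  proof (rule linear_coeff_nonpos_if_quadratic_bound[where c = c])
    fix t :: real assume t: "0 < t" "t < 1"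
    define N where "N = norm (xs + (- t) *\<^sub>R g)"
    have d: "\<bar>norm xs - N\<bar> \<le> t * norm g"
      using norm_triangle_ineq3[of xs "xs + (- t) *\<^sub>R g"] t by (simp add: N_def)
    then have "\<bar>norm xs - N\<bar>\<^sup>2 \<le> (t * norm g)\<^sup>2" by (intro power_mono) auto
    then have "(norm xs - N)\<^sup>2 \<le> t\<^sup>2 * (norm g)\<^sup>2" by (simp add: power_mult_distrib)
    moreover have "t * norm g \<le> norm g" using t mult_right_mono[of t 1 "norm g"] by simp
    then have "norm xs + 2 * N \<le> 3 * norm xs + 2 * norm g" using d by linarith
    ultimately have "\<rho> / 6 * (norm xs - N)\<^sup>2 * (norm xs + 2 * N)
        \<le> \<rho> / 6 * (t\<^sup>2 * (norm g)\<^sup>2) * (3 * norm xs + 2 * norm g)"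
      using rho_nonneg by (intro mult_mono mult_left_mono) (auto simp: N_def)
    moreover have "((- t) *\<^sub>R g) \<bullet> (A *v ((- t) *\<^sub>R g)) = t\<^sup>2 * (g \<bullet> (A *v g))"
      by (simp only: linear_scale[OF matrix_vector_mul_linear] inner_scaleR_left inner_scaleR_right)
        (simp add: power2_eq_square)
    moreover have "((- t) *\<^sub>R g) \<bullet> ((- t) *\<^sub>R g) = t\<^sup>2 * (g \<bullet> g)" by (simp add: power2_eq_square)
    moreover have "g \<bullet> ((- t) *\<^sub>R g) = - (t * (g \<bullet> g))" by simp
    moreover have "q \<le> (X + shift * Y) / 2 + r'"
      if "r \<le> r'" "u - w = (X + shift * Y) / 2 + - q + r" "w \<le> u" for q X Y r r' u w :: real
      using that by linarith
    ultimately have "t * (g \<bullet> g) \<le> (t\<^sup>2 * (g \<bullet> (A *v g)) + shift * (t\<^sup>2 * (g \<bullet> g))) / 2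
        + \<rho> / 6 * (t\<^sup>2 * (norm g)\<^sup>2) * (3 * norm xs + 2 * norm g)"
      using objective_expansion[of "(- t) *\<^sub>R g"] minimal[of "xs + (- t) *\<^sub>R g"]
      unfolding N_def[symmetric] g_def[symmetric] by metis
    also have "\<dots> = t\<^sup>2 * c" by (simp add: c_def distrib_left add_divide_distrib mult_ac)
    finally show "t * (g \<bullet> g) \<le> t\<^sup>2 * c" .
  qed
  then have "g = 0" using inner_ge_zero[of g] by (metis inner_eq_zero_iff order_antisym)
  then show ?thesis by (simp add: g_def)
qed

lemma coord_b: "v \<in> B \<Longrightarrow> v \<bullet> b = - (ev v + shift) * (v \<bullet> xs)"
  using arg_cong[OF stationary, of "\<lambda>x. v \<bullet> x"]
  by (simp add: inner_add_right coord_mult algebra_simps)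

text \<open>Stationarity removes the linear term of the expansion. On the sphere of radius
  \<open>norm xs\<close> only the quadratic form remains.\<close>

lemma objective_gap:
  "cubic_objective A b \<rho> x - cubic_objective A b \<rho> xs
    = (\<Sum>v\<in>B. (ev v + shift) * (v \<bullet> x - v \<bullet> xs)\<^sup>2) / 2
      + \<rho> / 6 * (norm xs - norm x)\<^sup>2 * (norm xs + 2 * norm x)"
  using objective_expansion[of "x - xs"] shifted_form_coords[of "x - xs" "- shift"]
  by (simp add: stationary inner_diff_right)

text \<open>Global minimality is compared along the line through \<open>xs\<close> in the direction
  \<open>v\<close>: at a distant point if \<open>v\<close> is not orthogonal to \<open>xs\<close>,
  and at nearby points if it is.\<close>

lemma shifted_ev_nonneg:
  assumes v: "v \<in> B"
  shows "0 \<le> ev v + shift"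
proof -
  have vv: "v \<bullet> v = 1" using norm_basis[OF v] by (simp add: dot_square_norm)
  have exp: "0 \<le> a\<^sup>2 * (ev v + shift) / 2
      + \<rho> / 6 * (norm xs - norm (xs + a *\<^sub>R v))\<^sup>2 * (norm xs + 2 * norm (xs + a *\<^sub>R v))" for a
  proof -
    have "(a *\<^sub>R v) \<bullet> (A *v (a *\<^sub>R v)) = a\<^sup>2 * ev v"
      using coord_mult[OF v, of v] vv
      by (simp add: linear_scale[OF matrix_vector_mul_linear] power2_eq_square)
    then have "((a *\<^sub>R v) \<bullet> (A *v (a *\<^sub>R v)) + shift * ((a *\<^sub>R v) \<bullet> (a *\<^sub>R v))) / 2
        = a\<^sup>2 * (ev v + shift) / 2"
      using vv by (simp add: power2_eq_square algebra_simps)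
    moreover have "0 \<le> cubic_objective A b \<rho> (xs + a *\<^sub>R v) - cubic_objective A b \<rho> xs"
      using minimal by simp
    ultimately show ?thesis
      by (simp only: objective_expansion stationary inner_zero_left add_0_right)
  qed
  show ?thesis
  proof (cases "v \<bullet> xs = 0")
    case False
    \<comment> \<open>This step reflects \<open>xs\<close> in the hyperplane orthogonal to
      \<open>v\<close>; the norm is preserved, so the cubic remainder vanishes.\<close>
    define a where "a = - 2 * (v \<bullet> xs)"
    have "(norm (xs + a *\<^sub>R v))\<^sup>2 = (norm xs)\<^sup>2"
      unfolding power2_norm_eq_inner using vv
      by (simp add: a_def inner_add_left inner_add_right inner_commute algebra_simps)
    then have "norm (xs + a *\<^sub>R v) = norm xs" by simp
    then have "0 \<le> a\<^sup>2 * (ev v + shift)" using exp[of a] by simp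
    moreover have "a\<^sup>2 > 0" using False by (simp add: a_def)
    ultimately show ?thesis by (simp add: zero_le_mult_iff)
  next
    case True
    \<comment> \<open>For orthogonal \<open>v\<close> the squared norm grows by t^2, so the
      remainder is at most \<rho>/3 times t^3, which is of smaller order than the quadratic
      term.\<close>
    have "- (ev v + shift) / 2 \<le> 0"
    proof (rule linear_coeff_nonpos_if_quadratic_bound[where c = "\<rho> / 3"])
      fix t :: real assume t: "0 < t" "t < 1"
      define R N where "R = norm xs" and "N = norm (xs + t *\<^sub>R v)"
      have "N\<^sup>2 = R\<^sup>2 + t\<^sup>2"
        unfolding R_def N_def power2_norm_eq_inner using vv True
        by (simp add: inner_add_left inner_add_right inner_commute power2_eq_square algebra_simps)
      then have sq: "(N - R) * (N + R) = t\<^sup>2" by (simp add: power2_eq_square algebra_simps)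
      have RN: "R \<ge> 0" "N \<ge> 0" by (auto simp: R_def N_def)
      have Nt: "N \<le> R + t"
        using norm_triangle_ineq[of xs "t *\<^sub>R v"] norm_basis[OF v] t by (simp add: R_def N_def)
      have "R\<^sup>2 \<le> N\<^sup>2" using \<open>N\<^sup>2 = _\<close> by simp
      then have "R \<le> N" using RN(2) by (rule power2_le_imp_le)
      have "(R - N)\<^sup>2 * (R + 2 * N) \<le> (R - N)\<^sup>2 * (2 * (N + R))"
        using RN by (intro mult_left_mono) auto
      also have "\<dots> = 2 * (N - R) * ((N - R) * (N + R))" by (simp add: power2_eq_square algebra_simps)
      also have "\<dots> \<le> 2 * t * t\<^sup>2" unfolding sq using Nt by (intro mult_right_mono) auto
      finally have "\<rho> / 6 * ((R - N)\<^sup>2 * (R + 2 * N)) \<le> \<rho> / 6 * (2 * t * t\<^sup>2)"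
        using rho_nonneg by (intro mult_left_mono) auto
      then have rem: "\<rho> / 6 * (R - N)\<^sup>2 * (R + 2 * N) \<le> \<rho> / 6 * (2 * t * t\<^sup>2)"
        by (simp only: mult.assoc)
      have "0 \<le> t\<^sup>2 * (ev v + shift) / 2 + \<rho> / 6 * (2 * t * t\<^sup>2)"
        by (rule order_trans[OF exp[of t] add_left_mono[OF rem[unfolded R_def N_def]]])
      moreover have "t * (t * (- (ev v + shift) / 2)) = - (t\<^sup>2 * (ev v + shift) / 2)"
        "t * (t\<^sup>2 * (\<rho> / 3)) = \<rho> / 6 * (2 * t * t\<^sup>2)"
        by (simp_all add: power2_eq_square algebra_simps)
      ultimately have "t * (t * (- (ev v + shift) / 2)) \<le> t * (t\<^sup>2 * (\<rho> / 3))" by linarith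
      then show "t * (- (ev v + shift) / 2) \<le> t\<^sup>2 * (\<rho> / 3)"
        by (simp only: mult_le_cancel_left_pos[OF t(1)])
    qed
    then show ?thesis by simp
  qed
qed

end

text \<open>As \<open>y\<close> lies in the ball, the line meets the sphere at one nonnegative and
  one nonpositive parameter, so the sign opposing \<open>g\<close> is available. The step is a chord
  piece, hence no longer than the diameter.\<close>

lemma sphere_line_intersection:
  fixes y z :: "'a::real_inner" and g :: real
  assumes "norm y \<le> R" "norm z = 1"
  obtains \<alpha> where "norm (y + \<alpha> *\<^sub>R z) = R" "\<alpha> * g \<le> 0" "\<bar>\<alpha>\<bar> \<le> 2 * R"
proof -
  define p where "p = y \<bullet> z"
  define q where "q = R\<^sup>2 - (norm y)\<^sup>2"
  define s where "s = sqrt (p\<^sup>2 + q)"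
  define \<alpha> where "\<alpha> = (if g \<le> 0 then s - p else - s - p)"
  have R: "R \<ge> 0" using assms(1) norm_ge_zero order_trans by blast
  have "q \<ge> 0" using assms(1) by (simp add: q_def power_mono)
  then have s: "s\<^sup>2 = p\<^sup>2 + q" by (simp add: s_def)
  have "\<bar>p\<bar> \<le> s" using \<open>q \<ge> 0\<close> by (auto simp: s_def intro: real_le_rsqrt)
  then have "\<alpha> * g \<le> 0" by (auto simp: \<alpha>_def mult_le_0_iff)
  have "(norm (y + \<alpha> *\<^sub>R z))\<^sup>2 = (norm y)\<^sup>2 + 2 * \<alpha> * p + \<alpha>\<^sup>2"
  proof -
    have "z \<bullet> z = 1" using assms(2) by (simp add: dot_square_norm)
    then show ?thesis
      unfolding power2_norm_eq_inner p_def
      by (simp add: inner_add_left inner_add_right inner_commute power2_eq_square[of \<alpha>] algebra_simps)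
  qed
  also have "\<dots> = (norm y)\<^sup>2 + ((\<alpha> + p)\<^sup>2 - p\<^sup>2)" 
    by (simp add: power2_sum)
  also have "(\<alpha> + p)\<^sup>2 = s\<^sup>2" by (simp add: \<alpha>_def power2_eq_square)
  finally have "(norm (y + \<alpha> *\<^sub>R z))\<^sup>2 = R\<^sup>2" using s by (simp add: q_def)
  then have nR: "norm (y + \<alpha> *\<^sub>R z) = R" using R by simp
  have "\<bar>\<alpha>\<bar> = norm ((y + \<alpha> *\<^sub>R z) - y)" using assms(2) by simp
  also have "\<dots> \<le> norm (y + \<alpha> *\<^sub>R z) + norm y" by (rule norm_triangle_ineq4)
  finally have "\<bar>\<alpha>\<bar> \<le> 2 * R" using nR assms(1) by simp
  then show ?thesis using that nR \<open>\<alpha> * g \<le> 0\<close> by blast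
qed

context cubic_minimizer
begin

section \<open>The linear rate\<close>

lemma krylov_0: "0 \<in> krylov A b t"
  unfolding krylov_def by (rule span_zero)

text \<open>The witness is the Chebyshev residual point rescaled to the sphere through
  \<open>xs\<close>. Its gap is then a quadratic form with small relative error in each coordinate,
  compared with the form at \<open>xs\<close>, half of which is at most f(0) - f(xs).\<close>

lemma linear_rate_witness:
  assumes "t \<ge> 1" "0 < m" "m \<le> L" and ev: "\<And>v. v \<in> B \<Longrightarrow> m \<le> ev v + shift \<and> ev v + shift \<le> L"
  shows "\<exists>x\<in>krylov A b t. cubic_objective A b \<rho> x - cubic_objective A b \<rho> xs
    \<le> 36 * (cubic_objective A b \<rho> 0 - cubic_objective A b \<rho> xs) * exp (- 4 * real t * sqrt (m / L))"
proof -
  let ?f = "cubic_objective A b \<rho>"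
  define \<epsilon> where "\<epsilon> = 2 * exp (- 2 * real t * sqrt (m / L))"
  define R where "R = norm xs"
  have "(exp (- 2 * real t * sqrt (m / L)))\<^sup>2 = exp (- 4 * real t * sqrt (m / L))"
    by (simp add: power2_eq_square flip: exp_add)
  \<comment> \<open>The constant 36 is the square of 6: a factor 2 from the Chebyshev bound in
    \<open>\<epsilon>\<close> and a factor 3 from rescaling.\<close>
  then have rate: "36 * d * exp (- 4 * real t * sqrt (m / L)) = (3 * \<epsilon>)\<^sup>2 * d" for d
    by (simp add: \<epsilon>_def power_mult_distrib)
  have f0: "?f 0 - ?f xs \<ge> 0" using minimal by simp
  have e0: "\<epsilon> > 0" by (simp add: \<epsilon>_def)
  consider "\<epsilon> > 1/3" | "R = 0" | "\<epsilon> \<le> 1/3" "R > 0" by (force simp: R_def)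
  then show ?thesis
  proof cases
    case 1
    then have "1 \<le> (3 * \<epsilon>)\<^sup>2" by (intro one_le_power) simp
    then have "1 * (?f 0 - ?f xs) \<le> (3 * \<epsilon>)\<^sup>2 * (?f 0 - ?f xs)" using f0 by (intro mult_right_mono)
    then show ?thesis unfolding rate using krylov_0 by auto
  next
    case 2
    then have "?f 0 - ?f xs = 0" by (simp add: R_def)
    then show ?thesis unfolding rate using krylov_0 by (intro bexI[of _ 0]) auto
  next
    case 3
    obtain r where r: "degree r \<le> t" "poly r 0 = 1" "\<And>z. m \<le> z \<Longrightarrow> z \<le> L \<Longrightarrow> \<bar>poly r z\<bar> \<le> \<epsilon>"
      using chebyshev_residual[OF assms(2,3,1)] unfolding \<epsilon>_def by blast
    define y where "y = combo (\<lambda>v. (1 - poly r (ev v + shift)) * (v \<bullet> xs))"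
    have yK: "y \<in> krylov A b t"
      unfolding y_def using combo_residual_in_krylov[OF r(1,2) assms(1), of b shift xs] coord_b by simp
    have re: "\<bar>poly r (ev v + shift)\<bar> \<le> \<epsilon>" if "v \<in> B" for v using r(3) ev[OF that] by blast
    have yc: "v \<bullet> y = (1 - poly r (ev v + shift)) * (v \<bullet> xs)" if "v \<in> B" for v
      using that by (simp add: y_def coord_combo)
    have "norm y \<le> (1 + \<epsilon>) * R" unfolding R_def
    proof (rule norm_le_if_coords_le)
      fix v assume v: "v \<in> B"
      have "\<bar>1 - poly r (ev v + shift)\<bar> \<le> 1 + \<epsilon>" using re[OF v] by linarith
      then show "\<bar>v \<bullet> y\<bar> \<le> (1 + \<epsilon>) * \<bar>v \<bullet> xs\<bar>" by (simp add: yc[OF v] abs_mult mult_right_mono)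
    qed (use e0 in simp)
    have "R \<le> 1 / (1 - \<epsilon>) * norm y" unfolding R_def
    proof (rule norm_le_if_coords_le)
      fix v assume v: "v \<in> B"
      have "1 - \<epsilon> \<le> \<bar>1 - poly r (ev v + shift)\<bar>" using re[OF v] by linarith
      then have "(1 - \<epsilon>) * \<bar>v \<bullet> xs\<bar> \<le> \<bar>v \<bullet> y\<bar>" by (simp add: yc[OF v] abs_mult mult_right_mono)
      then show "\<bar>v \<bullet> xs\<bar> \<le> 1 / (1 - \<epsilon>) * \<bar>v \<bullet> y\<bar>" using 3 by (simp add: field_simps)
    qed (use 3 in simp)
    then have "(1 - \<epsilon>) * R \<le> norm y" using 3 by (simp add: field_simps)
    then have ypos: "norm y > 0" using 3 mult_pos_pos[of "1 - \<epsilon>" R] by linarith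
    define c where "c = R / norm y"
    have c: "c > 0" "c * (1 - \<epsilon>) \<le> 1" "1 \<le> c * (1 + \<epsilon>)"
      using 3 ypos \<open>(1 - \<epsilon>) * R \<le> norm y\<close> \<open>norm y \<le> (1 + \<epsilon>) * R\<close>
      by (simp_all add: c_def divide_le_eq le_divide_eq mult.commute)
    \<comment> \<open>Both 1 and \<open>c * (1 - s)\<close> lie between
      \<open>c * (1 - \<epsilon>)\<close> and \<open>c * (1 + \<epsilon>)\<close>, so they differ by
      at most \<open>2 * c * \<epsilon>\<close>; \<open>\<epsilon> \<le> 1/3\<close> gives
      \<open>c \<le> 3/2\<close>.\<close>
    have "\<bar>c * (1 - s) - 1\<bar> \<le> 3 * \<epsilon>" if s: "\<bar>s\<bar> \<le> \<epsilon>" for s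
    proof -
      have "c * (1 - s) \<le> c * (1 + \<epsilon>)" using s c(1) by (intro mult_left_mono) auto
      moreover have "c * (1 - \<epsilon>) \<le> c * (1 - s)" using s c(1) by (intro mult_left_mono) auto
      moreover have "c * (2/3) \<le> c * (1 - \<epsilon>)" using 3 c(1) by (intro mult_left_mono) auto
      then have "c \<le> 3/2" using c(2) by linarith
      then have "c * \<epsilon> \<le> 3/2 * \<epsilon>" using e0 by (intro mult_right_mono) auto
      ultimately show ?thesis using c(2,3) by (simp add: algebra_simps abs_le_iff)
    qed
    note scaled = this
    define x where "x = c *\<^sub>R y"
    have xK: "x \<in> krylov A b t" using yK unfolding x_def krylov_def by (rule span_scale)
    have nx: "norm x = R" using c(1) ypos 3 by (simp add: x_def c_def)
    have "?f x - ?f xs = (\<Sum>v\<in>B. (ev v + shift) * (v \<bullet> x - v \<bullet> xs)\<^sup>2) / 2"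
      using objective_gap[of x] nx by (simp add: R_def)
    also have "\<dots> \<le> (\<Sum>v\<in>B. (3 * \<epsilon>)\<^sup>2 * ((ev v + shift) * (v \<bullet> xs)\<^sup>2)) / 2"
    proof (intro divide_right_mono sum_mono)
      fix v assume v: "v \<in> B"
      have "v \<bullet> x - v \<bullet> xs = (c * (1 - poly r (ev v + shift)) - 1) * (v \<bullet> xs)"
        by (simp add: x_def yc[OF v] algebra_simps)
      then have "(v \<bullet> x - v \<bullet> xs)\<^sup>2 = \<bar>c * (1 - poly r (ev v + shift)) - 1\<bar>\<^sup>2 * (v \<bullet> xs)\<^sup>2"
        by (simp add: power_mult_distrib)
      also have "\<dots> \<le> (3 * \<epsilon>)\<^sup>2 * (v \<bullet> xs)\<^sup>2"
        using scaled[OF re[OF v]] by (intro mult_right_mono power_mono) auto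
      finally have "(ev v + shift) * (v \<bullet> x - v \<bullet> xs)\<^sup>2 \<le> (ev v + shift) * ((3 * \<epsilon>)\<^sup>2 * (v \<bullet> xs)\<^sup>2)"
        using shifted_ev_nonneg[OF v] by (rule mult_left_mono)
      then show "(ev v + shift) * (v \<bullet> x - v \<bullet> xs)\<^sup>2 \<le> (3 * \<epsilon>)\<^sup>2 * ((ev v + shift) * (v \<bullet> xs)\<^sup>2)"
        by (simp only: mult_ac)
    qed simp
    also have "\<dots> = (3 * \<epsilon>)\<^sup>2 * ((\<Sum>v\<in>B. (ev v + shift) * (v \<bullet> xs)\<^sup>2) / 2)"
      unfolding sum_distrib_left[symmetric] by simp
    also have "\<dots> \<le> (3 * \<epsilon>)\<^sup>2 * (?f 0 - ?f xs)"
    proof (rule mult_left_mono)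
      have "0 \<le> \<rho> / 6 * (norm xs)\<^sup>2 * norm xs" using rho_nonneg by simp
      then show "(\<Sum>v\<in>B. (ev v + shift) * (v \<bullet> xs)\<^sup>2) / 2 \<le> ?f 0 - ?f xs"
        using objective_gap[of 0] by simp
    qed simp
    finally have "?f x - ?f xs \<le> (3 * \<epsilon>)\<^sup>2 * (?f 0 - ?f xs)" .
    then show ?thesis unfolding rate using xK by blast
  qed
qed

section \<open>The sublinear rate\<close>

text \<open>The convexified objective: it agrees with the cubic one up to a constant on spheres about the
  origin, and the minimizer of the latter minimizes it over the ball of radius \<open>norm xs\<close>.\<close>

definition convexified :: "real \<Rightarrow> real ^ 'n \<Rightarrow> real" where
  "convexified a x = (x \<bullet> (A *v x) - a * (x \<bullet> x)) / 2 + b \<bullet> x"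

lemma objective_eq_convexified:
  "cubic_objective A b \<rho> x = convexified a x + (a / 2 * (norm x)\<^sup>2 + \<rho> / 3 * norm x ^ 3)"
  by (simp add: cubic_objective_def convexified_def power2_norm_eq_inner diff_divide_distrib)

text \<open>A residual with values in [0, 1] only shrinks coordinates, so \<open>y\<close> stays in
  the ball. The convexified gap splits over eigendirections, and each piece is controlled by the
  bound on z r(z).\<close>

lemma convexified_rate_witness:
  assumes "t \<ge> 1" "0 \<le> a + shift" and ev: "\<And>v. v \<in> B \<Longrightarrow> a \<le> ev v \<and> ev v \<le> a + D" and "0 \<le> D"
  obtains y where "y \<in> krylov A b t" "norm y \<le> norm xs"
    "convexified a y - convexified a xs \<le> 4 * D / (real t - 1/2)\<^sup>2 * (norm xs)\<^sup>2"
proof -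
  define m where "m = a + shift"
  define K where "K = 4 * D / (real t - 1/2)\<^sup>2"
  obtain r where r: "degree r \<le> t" "poly r 0 = 1"
    "\<And>z. m \<le> z \<Longrightarrow> z \<le> m + D \<Longrightarrow> 0 \<le> poly r z \<and> poly r z \<le> 1 \<and> z * poly r z \<le> K"
    using sublinear_residual[OF _ assms(4,1), of m] assms(2) unfolding m_def K_def by blast
  define y where "y = combo (\<lambda>v. (1 - poly r (ev v + shift)) * (v \<bullet> xs))"
  have yK: "y \<in> krylov A b t"
    unfolding y_def using combo_residual_in_krylov[OF r(1,2) assms(1), of b shift xs] coord_b by simp
  have yc: "v \<bullet> y = (1 - poly r (ev v + shift)) * (v \<bullet> xs)" if "v \<in> B" for v
    using that by (simp add: y_def coord_combo)
  have re: "0 \<le> poly r (ev v + shift) \<and> poly r (ev v + shift) \<le> 1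
      \<and> (ev v + shift) * poly r (ev v + shift) \<le> K" if "v \<in> B" for v
    using r(3)[of "ev v + shift"] ev[OF that] by (simp add: m_def)
  have "norm y \<le> 1 * norm xs"
  proof (rule norm_le_if_coords_le)
    fix v assume v: "v \<in> B"
    have "\<bar>1 - poly r (ev v + shift)\<bar> \<le> 1" using re[OF v] by linarith
    then show "\<bar>v \<bullet> y\<bar> \<le> 1 * \<bar>v \<bullet> xs\<bar>" unfolding yc[OF v] abs_mult by (intro mult_right_mono) auto
  qed simp
  moreover have "convexified a y - convexified a xs \<le> K * (norm xs)\<^sup>2"
  proof -
    have F: "convexified a z = (\<Sum>v\<in>B. (ev v - a) * (v \<bullet> z)\<^sup>2 / 2 + (v \<bullet> b) * (v \<bullet> z))" for z
      unfolding convexified_def shifted_form_coords inner_coords[of b z] sum.distrib sum_divide_distrib ..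
    have "convexified a y - convexified a xs
        = (\<Sum>v\<in>B. ((ev v - a) * (v \<bullet> y)\<^sup>2 / 2 + (v \<bullet> b) * (v \<bullet> y))
            - ((ev v - a) * (v \<bullet> xs)\<^sup>2 / 2 + (v \<bullet> b) * (v \<bullet> xs)))"
      unfolding F by (simp only: sum_subtractf)
    also have "\<dots> \<le> (\<Sum>v\<in>B. K * (v \<bullet> xs)\<^sup>2)"
    proof (rule sum_mono)
      fix v assume v: "v \<in> B"
      define s where "s = poly r (ev v + shift)"
      define X where "X = v \<bullet> xs"
      define l where "l = ev v - a"
      have s: "0 \<le> s" "s \<le> 1" "(l + m) * s \<le> K" "0 \<le> l"
        using re[OF v] ev[OF v] by (simp_all add: s_def l_def m_def)
      have vb: "v \<bullet> b = - (l + m) * X" by (simp add: coord_b[OF v] l_def m_def X_def)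
      have "(l * (v \<bullet> y)\<^sup>2 / 2 + (v \<bullet> b) * (v \<bullet> y)) - (l * X\<^sup>2 / 2 + (v \<bullet> b) * X)
          = (l * s\<^sup>2 / 2 + m * s) * X\<^sup>2"
        unfolding yc[OF v] s_def[symmetric] X_def[symmetric] vb
        by (simp add: power2_eq_square field_simps)
      also have "\<dots> \<le> K * X\<^sup>2"
      proof (rule mult_right_mono)
        \<comment> \<open>As \<open>s\<close> lies in [0, 1], half of l s^2 is at most l s, so the
          coefficient is bounded by (l + m) s.\<close>
        have "s\<^sup>2 \<le> s" using s by (simp add: power2_eq_square mult_left_le)
        then have "l * s\<^sup>2 \<le> l * s" using s by (intro mult_left_mono)
        moreover have "0 \<le> l * s\<^sup>2" using s by simp
        ultimately show "l * s\<^sup>2 / 2 + m * s \<le> K" using s(3) by (simp add: distrib_right)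
      qed simp
      finally show "((ev v - a) * (v \<bullet> y)\<^sup>2 / 2 + (v \<bullet> b) * (v \<bullet> y))
            - ((ev v - a) * (v \<bullet> xs)\<^sup>2 / 2 + (v \<bullet> b) * (v \<bullet> xs)) \<le> K * (v \<bullet> xs)\<^sup>2"
        unfolding l_def X_def .
    qed
    also have "\<dots> = K * (norm xs)\<^sup>2" by (simp add: norm_sq_coords sum_distrib_left)
    finally show ?thesis .
  qed
  ultimately show ?thesis using that yK unfolding K_def by simp
qed

text \<open>For nonnegative \<open>a\<close> the terms separating the cubic from the convexified
  objective increase with the norm, so a point of the ball needs no move to the sphere.\<close>

lemma sublinear_rate_witness_convex:
  assumes "t \<ge> 1" "0 \<le> a" and ev: "\<And>v. v \<in> B \<Longrightarrow> a \<le> ev v \<and> ev v \<le> a + D" and "0 \<le> D"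
  shows "\<exists>x\<in>krylov A b t. cubic_objective A b \<rho> x - cubic_objective A b \<rho> xs
    \<le> D * (norm xs)\<^sup>2 / (real t - 1/2)\<^sup>2 * 4"
proof -
  obtain y where y: "y \<in> krylov A b t" "norm y \<le> norm xs"
    "convexified a y - convexified a xs \<le> 4 * D / (real t - 1/2)\<^sup>2 * (norm xs)\<^sup>2"
    using convexified_rate_witness[of t a D] assms shift_nonneg by auto
  have "a / 2 * (norm y)\<^sup>2 \<le> a / 2 * (norm xs)\<^sup>2" "\<rho> / 3 * norm y ^ 3 \<le> \<rho> / 3 * norm xs ^ 3"
    using y(2) assms(2) rho_nonneg by (intro mult_left_mono power_mono; simp)+
  then have "cubic_objective A b \<rho> y - cubic_objective A b \<rho> xs \<le> convexified a y - convexified a xs"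
    unfolding objective_eq_convexified[of _ a] by linarith
  also note y(3)
  finally show ?thesis using y(1) by (auto simp: mult_ac)
qed

text \<open>Moving from the convexified witness along an approximate eigenvector, in the direction of
  descent, reaches the sphere through the minimizer at the price of the Rayleigh quotient excess.\<close>

lemma sublinear_rate_witness_nonconvex:
  assumes "t \<ge> 1" and u: "u \<in> B" "u \<bullet> b \<noteq> 0"
    and ev: "\<And>v. v \<in> B \<Longrightarrow> ev u \<le> ev v \<and> ev v \<le> ev u + D"
  shows "\<exists>x\<in>krylov A b t. cubic_objective A b \<rho> x - cubic_objective A b \<rho> xs
    \<le> D * (norm xs)\<^sup>2 / (real t - 1/2)\<^sup>2 * (4 + 1 / 8 * (ln (4 * (norm b)\<^sup>2 / (u \<bullet> b)\<^sup>2))\<^sup>2)"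
proof -
  define a where "a = ev u"
  define R where "R = norm xs"
  define l where "l = (ln (4 * (norm b)\<^sup>2 / (u \<bullet> b)\<^sup>2))\<^sup>2"
  define T where "T = (real t - 1/2)\<^sup>2"
  have D0: "D \<ge> 0" using ev[OF u(1)] by simp
  have T0: "T > 0" unfolding T_def using \<open>t \<ge> 1\<close> by (simp add: field_simps)
  obtain y where y: "y \<in> krylov A b t" "norm y \<le> R" "convexified a y - convexified a xs \<le> 4 * D / T * R\<^sup>2"
    using convexified_rate_witness[of t a D] assms shifted_ev_nonneg[OF u(1)] D0
    unfolding a_def R_def T_def by auto
  obtain z where z: "z \<in> krylov A b t" "norm z = 1" "z \<bullet> (A *v z) - a * (z \<bullet> z) \<le> D * l / (16 * T)"
    using lanczos_vector[OF u ev \<open>t \<ge> 1\<close>] unfolding a_def l_def T_def by blast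
  \<comment> \<open>The derivative of the convexified objective at \<open>y\<close> along
    \<open>z\<close>; the sign of \<open>\<alpha>\<close> makes the linear term nonpositive.\<close>
  define g where "g = (A *v y) \<bullet> z - a * (y \<bullet> z) + b \<bullet> z"
  obtain \<alpha> where \<alpha>: "norm (y + \<alpha> *\<^sub>R z) = R" "\<alpha> * g \<le> 0" "\<bar>\<alpha>\<bar> \<le> 2 * R"
    using sphere_line_intersection[OF y(2) z(2)] by blast
  define x where "x = y + \<alpha> *\<^sub>R z"
  have "x \<in> krylov A b t"
    using y(1) z(1) unfolding x_def krylov_def by (intro span_add span_scale)
  moreover have "cubic_objective A b \<rho> x - cubic_objective A b \<rho> xs
    \<le> D * R\<^sup>2 / T * (4 + 1 / 8 * l)"
  proof -
    have "convexified a x = convexified a y + \<alpha> * g + \<alpha>\<^sup>2 / 2 * (z \<bullet> (A *v z) - a * (z \<bullet> z))"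
      using selfadjoint[of y z]
      by (simp add: x_def convexified_def g_def linear_scale[OF matrix_vector_mul_linear]
          matrix_vector_right_distrib inner_add_left inner_add_right inner_commute power2_eq_square field_simps)
    moreover have "\<alpha>\<^sup>2 / 2 * (z \<bullet> (A *v z) - a * (z \<bullet> z)) \<le> \<alpha>\<^sup>2 / 2 * (D * l / (16 * T))"
      using z(3) by (intro mult_left_mono) auto
    \<comment> \<open>The diameter bound on \<open>\<alpha>\<close> turns the factor 1/16 of the
      Lanczos estimate into the final 1/8.\<close>
    moreover have "\<alpha>\<^sup>2 / 2 * (D * l / (16 * T)) \<le> (2 * R)\<^sup>2 / 2 * (D * l / (16 * T))"
      using power_mono[OF \<alpha>(3), of 2] D0 T0 by (intro mult_right_mono divide_right_mono) (auto simp: l_def)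
    ultimately have "convexified a x - convexified a xs \<le> 4 * D / T * R\<^sup>2 + (2 * R)\<^sup>2 / 2 * (D * l / (16 * T))"
      using y(3) \<alpha>(2) by linarith
    also have "\<dots> = D * R\<^sup>2 / T * (4 + 1 / 8 * l)" using T0 by (simp add: power_mult_distrib field_simps)
    finally show ?thesis
      using \<alpha>(1) unfolding objective_eq_convexified[of _ a] by (simp add: x_def R_def)
  qed
  ultimately show ?thesis unfolding R_def l_def T_def by blast
qed

end

section \<open>Combination of the two rates\<close>

theorem corollary4p2:
  fixes A :: "real ^ 'n ^ 'n" and b :: "real ^ 'n" and \<rho> :: real
    and v_min x_star :: "real ^ 'n" and x :: "nat \<Rightarrow> real ^ 'n"
  defines "f \<equiv> cubic_objective A b \<rho>"
  assumes symmetric: "transpose A = A"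
    and rho: "\<rho> \<ge> 0"
    and v_min: "norm v_min = 1" "A *v v_min = lambda_min A *\<^sub>R v_min"
    and x_star: "is_arg_min f (\<lambda>y. y \<in> UNIV) x_star"
    and x: "\<forall>t\<ge>1. is_arg_min f (\<lambda>y. y \<in> krylov A b t) (x t)"
  shows "\<forall>t\<ge>1.
      f (x t) - f x_star
        \<le> 36 * (f 0 - f x_star) *
            exp (- 4 * real t *
              sqrt ((lambda_min A + \<rho> * norm x_star) / (lambda_max A + \<rho> * norm x_star)))
    \<and> ((lambda_min A < 0 \<longrightarrow> v_min \<bullet> b \<noteq> 0) \<longrightarrow>
        f (x t) - f x_star
          \<le> (lambda_max A - lambda_min A) * (norm x_star)\<^sup>2 / (real t - 1/2)\<^sup>2 *
              (4 + of_bool (lambda_min A < 0) / 8 *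
                     (ln (4 * (norm b)\<^sup>2 / (v_min \<bullet> b)\<^sup>2))\<^sup>2))"
proof (intro allI impI)
  fix t :: nat assume t: "t \<ge> 1"
  obtain B ev where "eigenbasis A B ev" and uB: "v_min \<in> B"
    using symmetric_eigenbasis_containing[OF symmetric v_min] by blast
  then interpret eigenbasis A B ev by simp
  interpret cubic_minimizer A B ev b \<rho> x_star
    using rho x_star unfolding f_def
    by unfold_locales (auto simp: is_arg_min_linorder)
  have best: "f (x t) \<le> f y" if "y \<in> krylov A b t" for y
    using x t that by (simp add: is_arg_min_linorder)
  have shift: "\<rho> * norm x_star = shift" by (simp add: shift_def)
  have "ev v_min *\<^sub>R v_min = lambda_min A *\<^sub>R v_min" using eigenvector[OF uB] v_min(2) by (rule subst)
  moreover have "v_min \<noteq> 0" using v_min(1) by auto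
  ultimately have ev_u: "ev v_min = lambda_min A" by simp
  note ev = ev_ge_lambda_min ev_le_lambda_max
  have le: "lambda_min A \<le> lambda_max A" using ev(2)[OF uB] ev_u by simp
  let ?D = "lambda_max A - lambda_min A"
  have f0: "f 0 - f x_star \<ge> 0" using minimal by (simp add: f_def)
  have "f (x t) - f x_star \<le> 36 * (f 0 - f x_star) *
      exp (- 4 * real t * sqrt ((lambda_min A + shift) / (lambda_max A + shift)))"
  proof (cases "lambda_min A + shift = 0")
    \<comment> \<open>The ratio is 0, also as 0/0, so the exponential is 1 and comparison with the
      point 0 of the Krylov subspace suffices.\<close>
    case True
    then show ?thesis using best[OF krylov_0] f0 by simp
  next
    case False
    then have "0 < lambda_min A + shift" using shifted_ev_nonneg[OF uB] ev_u by simp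
    then obtain y where "y \<in> krylov A b t" "f y - f x_star \<le> 36 * (f 0 - f x_star) *
      exp (- 4 * real t * sqrt ((lambda_min A + shift) / (lambda_max A + shift)))"
      using linear_rate_witness[OF t, of "lambda_min A + shift" "lambda_max A + shift"] le ev
      unfolding f_def by auto
    then show ?thesis using best[of y] by linarith
  qed
  moreover have "f (x t) - f x_star \<le> ?D * (norm x_star)\<^sup>2 / (real t - 1/2)\<^sup>2 *
      (4 + of_bool (lambda_min A < 0) / 8 * (ln (4 * (norm b)\<^sup>2 / (v_min \<bullet> b)\<^sup>2))\<^sup>2)"
    if nz: "lambda_min A < 0 \<longrightarrow> v_min \<bullet> b \<noteq> 0"
  proof -
    have "\<exists>y\<in>krylov A b t. f y - f x_star \<le> ?D * (norm x_star)\<^sup>2 / (real t - 1/2)\<^sup>2 *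
      (4 + of_bool (lambda_min A < 0) / 8 * (ln (4 * (norm b)\<^sup>2 / (v_min \<bullet> b)\<^sup>2))\<^sup>2)"
    proof (cases "lambda_min A < 0")
      case True
      then show ?thesis
        using sublinear_rate_witness_nonconvex[OF t uB, of ?D] nz ev by (simp add: f_def ev_u)
    next
      case False
      then show ?thesis
        using sublinear_rate_witness_convex[OF t, of "lambda_min A" ?D] le ev by (simp add: f_def)
    qed
    then obtain y where "y \<in> krylov A b t" "f y - f x_star \<le> ?D * (norm x_star)\<^sup>2 / (real t - 1/2)\<^sup>2 *
      (4 + of_bool (lambda_min A < 0) / 8 * (ln (4 * (norm b)\<^sup>2 / (v_min \<bullet> b)\<^sup>2))\<^sup>2)" by blast
    then show ?thesis using best[of y] by linarith
  qed
  ultimately show "f (x t) - f x_star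
        \<le> 36 * (f 0 - f x_star) *
            exp (- 4 * real t *
              sqrt ((lambda_min A + \<rho> * norm x_star) / (lambda_max A + \<rho> * norm x_star)))
    \<and> ((lambda_min A < 0 \<longrightarrow> v_min \<bullet> b \<noteq> 0) \<longrightarrow>
        f (x t) - f x_star
          \<le> (lambda_max A - lambda_min A) * (norm x_star)\<^sup>2 / (real t - 1/2)\<^sup>2 *
              (4 + of_bool (lambda_min A < 0) / 8 *
                     (ln (4 * (norm b)\<^sup>2 / (v_min \<bullet> b)\<^sup>2))\<^sup>2))"
    unfolding shift by blast
qed

end
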